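(* Let $B \ge 2$ be an integer and let $X = x_1, \dots, x_m$ be any sequence of searches over the keys $\{1,\dots,N\}$. Then $\mathrm{OPT}_{\mathrm{BST}}(X) = O(\mathrm{OPT}_{\mathrm{Btree}}(X) \cdot \log B)$, where $\mathrm{OPT}_{\mathrm{BST}}(X)$ and $\mathrm{OPT}_{\mathrm{Btree}}(X)$ denote the optimal offline costs of serving $X$ in the BST model and in the B-tree model with parameter $B$, respectively.
   Context: Keys are $\{1,\dots,N\}$; a search sequence is $X = x_1,\dots,x_m$ with each $x_i$ a key. BST model: the keys are stored in a binary search tree (one key per node, in-order condition). To serve search $x_i$, a single pointer is initialized at the root (unit cost), and then the algorithm performs unit-cost operations: move the pointer to the parent or to the left/right child of the current node, or rotate the edge between the current node and its parent. A node is touched when the pointer is at it; the search is correct if the node containing $x_i$ is touched. Nodes may store $O(\log N)$ extra bits. B-tree model with parameter $B\ge 2$: each node $v$ stores $n(v) \le B-1$ keys $x_1<\dots<x_{n(v)}$ and has $n(v)+1$ child pointers (possibly null), with the in-order condition (all keys in the $i$-th child subtree lie strictly between $x_{i-1}$ and $x_i$). To serve search $x_i$, a single pointer is initialized at the root (unit cost) and the algorithm performs unit-cost operations, and must touch the node containing $x_i$: (1) move the pointer to a child or the parent of the current node; (2) split a node $u$ with at least three keys at a key $u_m$ that is neither its smallest nor largest key, provided its parent is not full ($u_m$ is moved into the parent and $u$ is replaced by two nodes holding the keys smaller, resp. larger, than $u_m$; to split the root, first create a new empty root above it); (3) join two sibling nodes $u,v$ holding at most $B-2$ keys in total that are separated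 by a unique key $p_j$ of their parent $p$ ($p_j$ is moved down, $u$, $p_j$, $v$ become one node; if $p$ becomes empty it is removed); (4) rotate the edge between the current node $u$ and its parent $p(u)$: letting $P=\{p_1<\dots<p_m\}$ be the union of keys of $u$ and $p(u)$, the keys of $u$ form a contiguous interval $[p_\ell,p_r]$ of $P$, and the rotation replaces it by any other contiguous interval $[p_{\ell'},p_{r'}]$, redistributing keys (and subtrees) accordingly, as long as both nodes still hold at most $B-1$ keys. Nodes may store $O(B\log N)$ extra bits. The cost of an algorithm on $X$ is the total number of unit-cost operations; $\mathrm{OPT}$ in a model is the minimum cost over all offline algorithms in that model. For $B=2$ the B-tree model coincides with the BST model. *)

theory Defs
  imports Complex_Main "HOL-Library.Tree"
begin

text \<open>
  In both models a configuration is a pair of a search tree and a pointer, the pointer being the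
  path from the root to the current node.  A model is given by its unit-cost transition relation
  between configurations and by the set of keys stored in the current node.  Extra bits stored in
  the nodes play no role for offline algorithms, which are arbitrary sequences of transitions.
\<close>

type_synonym ('t, 'd) config = "'t \<times> 'd list"

text \<open>
  One search: the pointer starts at the root (cost 1); after \<open>i\<close> operations the current
  node contains \<open>x\<close>, and \<open>j\<close> further operations may follow.
\<close>

definition serves1 ::
  "(('t, 'd) config \<Rightarrow> ('t, 'd) config \<Rightarrow> bool) \<Rightarrow> (('t, 'd) config \<Rightarrow> nat set) \<Rightarrow>
    nat \<Rightarrow> 't \<Rightarrow> 't \<Rightarrow> nat \<Rightarrow> bool" where
  "serves1 step node_keys x t t' c \<longleftrightarrow>
     (\<exists>i j s q. (step ^^ i) (t, []) s \<and> x \<in> node_keys s \<and> (step ^^ j) s (t', q) \<and>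
        c = 1 + i + j)"

fun serves ::
  "(('t, 'd) config \<Rightarrow> ('t, 'd) config \<Rightarrow> bool) \<Rightarrow> (('t, 'd) config \<Rightarrow> nat set) \<Rightarrow>
    nat list \<Rightarrow> 't \<Rightarrow> 't \<Rightarrow> nat \<Rightarrow> bool" where
  "serves step node_keys [] t t' c \<longleftrightarrow> t' = t \<and> c = 0"
| "serves step node_keys (x # xs) t t' c \<longleftrightarrow>
     (\<exists>t'' c1 c2. serves1 step node_keys x t t'' c1 \<and> serves step node_keys xs t'' t' c2 \<and>
        c = c1 + c2)"


section \<open>The BST model\<close>

datatype dir = L | R

fun bst_sub :: "nat tree \<Rightarrow> dir list \<Rightarrow> nat tree" where
  "bst_sub t [] = t"
| "bst_sub (Node l k r) (L # p) = bst_sub l p"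
| "bst_sub (Node l k r) (R # p) = bst_sub r p"
| "bst_sub Leaf (d # p) = Leaf"

fun bst_put :: "nat tree \<Rightarrow> dir list \<Rightarrow> nat tree \<Rightarrow> nat tree" where
  "bst_put t [] s = s"
| "bst_put (Node l k r) (L # p) s = Node (bst_put l p s) k r"
| "bst_put (Node l k r) (R # p) s = Node l k (bst_put r p s)"
| "bst_put Leaf (d # p) s = Leaf"

fun bst_node_keys :: "(nat tree, dir) config \<Rightarrow> nat set" where
  "bst_node_keys (t, p) = (case bst_sub t p of Leaf \<Rightarrow> {} | Node l k r \<Rightarrow> {k})"

inductive bst_step :: "(nat tree, dir) config \<Rightarrow> (nat tree, dir) config \<Rightarrow> bool" where
  left: "bst_sub t p = Node l k r \<Longrightarrow> l \<noteq> Leaf \<Longrightarrow> bst_step (t, p) (t, p @ [L])"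
| right: "bst_sub t p = Node l k r \<Longrightarrow> r \<noteq> Leaf \<Longrightarrow> bst_step (t, p) (t, p @ [R])"
| parent: "bst_step (t, p @ [d]) (t, p)"
| rotate_left_child: "bst_sub t p = Node (Node a x b) y c \<Longrightarrow>
    bst_step (t, p @ [L]) (bst_put t p (Node a x (Node b y c)), p)"
| rotate_right_child: "bst_sub t p = Node a x (Node b y c) \<Longrightarrow>
    bst_step (t, p @ [R]) (bst_put t p (Node (Node a x b) y c), p)"

text \<open>The initial tree is part of the offline algorithm.\<close>

definition bst_costs :: "nat \<Rightarrow> nat list \<Rightarrow> nat set" where
  "bst_costs N X = {c. \<exists>t t'. bst t \<and> set_tree t = {1..N} \<and> serves bst_step bst_node_keys X t t' c}"

definition opt_bst :: "nat \<Rightarrow> nat list \<Rightarrow> nat" where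
  "opt_bst N X = Inf (bst_costs N X)"


section \<open>The B-tree model\<close>

datatype btree = Null | BNode "nat list" "btree list"

fun btree_keys :: "btree \<Rightarrow> nat set" where
  "btree_keys Null = {}"
| "btree_keys (BNode ks ts) = set ks \<union> (\<Union>t\<in>set ts. btree_keys t)"

text \<open>Nodes are nonempty; indices start from 0, so child \<open>i\<close> lies between the keys
  \<open>i - 1\<close> and \<open>i\<close>.\<close>

fun is_btree :: "nat \<Rightarrow> btree \<Rightarrow> bool" where
  "is_btree B Null \<longleftrightarrow> True"
| "is_btree B (BNode ks ts) \<longleftrightarrow>
     ks \<noteq> [] \<and> length ks \<le> B - 1 \<and> length ts = length ks + 1 \<and> sorted_wrt (<) ks \<and>
     (\<forall>i < length ts. \<forall>x \<in> btree_keys (ts ! i).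
        (0 < i \<longrightarrow> ks ! (i - 1) < x) \<and> (i < length ks \<longrightarrow> x < ks ! i)) \<and>
     (\<forall>t \<in> set ts. is_btree B t)"

fun btree_sub :: "btree \<Rightarrow> nat list \<Rightarrow> btree" where
  "btree_sub t [] = t"
| "btree_sub (BNode ks ts) (i # p) = (if i < length ts then btree_sub (ts ! i) p else Null)"
| "btree_sub Null (i # p) = Null"

fun btree_put :: "btree \<Rightarrow> nat list \<Rightarrow> btree \<Rightarrow> btree" where
  "btree_put t [] s = s"
| "btree_put (BNode ks ts) (i # p) s =
     (if i < length ts then BNode ks (ts[i := btree_put (ts ! i) p s]) else BNode ks ts)"
| "btree_put Null (i # p) s = Null"

fun btree_node_keys :: "(btree, nat) config \<Rightarrow> nat set" where
  "btree_node_keys (t, p) = (case btree_sub t p of Null \<Rightarrow> {} | BNode ks ts \<Rightarrow> set ks)"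

text \<open>
  In the rules below \<open>p\<close> is the path of the parent, with keys \<open>ks\<close> and children \<open>ts\<close>;
  \<open>us\<close>, \<open>vs\<close> are the keys and children of the current node (for a join: \<open>us1\<close>, \<open>vs1\<close> and
  \<open>us2\<close>, \<open>vs2\<close> for the two siblings, the pointer being at either of them).
  A parent that becomes empty is removed, its only child taking its place.
  After a split or a rotation the pointer is at either of the two resulting nodes, as the
  algorithm chooses.  In a rotation, \<open>as @ bs @ cs\<close> is the increasing list of the keys of both
  nodes and \<open>bs\<close> is the new interval; \<open>ds @ es @ fs\<close> is the list of all subtrees hanging
  from the two nodes.
\<close>

inductive btree_step :: "nat \<Rightarrow> (btree, nat) config \<Rightarrow> (btree, nat) config \<Rightarrow> bool"
  for B :: nat where
  child: "btree_sub t p = BNode ks ts \<Longrightarrow> i < length ts \<Longrightarrow> ts ! i \<noteq> Null \<Longrightarrow>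
    btree_step B (t, p) (t, p @ [i])"
| parent: "btree_step B (t, p @ [i]) (t, p)"
| split:
    "btree_sub t p = BNode (ks1 @ ks2) (ts1 @ BNode (us1 @ k # us2) (vs1 @ vs2) # ts2) \<Longrightarrow>
     length ts1 = length ks1 \<Longrightarrow> length vs1 = length us1 + 1 \<Longrightarrow> us1 \<noteq> [] \<Longrightarrow> us2 \<noteq> [] \<Longrightarrow>
     length (ks1 @ ks2) < B - 1 \<Longrightarrow> j \<in> {length ts1, length ts1 + 1} \<Longrightarrow>
     btree_step B (t, p @ [length ts1])
       (btree_put t p (BNode (ks1 @ k # ks2) (ts1 @ BNode us1 vs1 # BNode us2 vs2 # ts2)),
        p @ [j])"
| split_root:
    "length vs1 = length us1 + 1 \<Longrightarrow> us1 \<noteq> [] \<Longrightarrow> us2 \<noteq> [] \<Longrightarrow> j \<in> {0, 1} \<Longrightarrow>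
     btree_step B (BNode (us1 @ k # us2) (vs1 @ vs2), [])
       (BNode [k] [BNode us1 vs1, BNode us2 vs2], [j])"
| join:
    "btree_sub t p = BNode (ks1 @ k # ks2) (ts1 @ BNode us1 vs1 # BNode us2 vs2 # ts2) \<Longrightarrow>
     length ts1 = length ks1 \<Longrightarrow> ks1 @ ks2 \<noteq> [] \<Longrightarrow> length us1 + length us2 \<le> B - 2 \<Longrightarrow>
     j \<in> {length ts1, length ts1 + 1} \<Longrightarrow>
     btree_step B (t, p @ [j])
       (btree_put t p (BNode (ks1 @ ks2) (ts1 @ BNode (us1 @ k # us2) (vs1 @ vs2) # ts2)),
        p @ [length ts1])"
| join_remove:
    "btree_sub t p = BNode [k] [BNode us1 vs1, BNode us2 vs2] \<Longrightarrow>
     length us1 + length us2 \<le> B - 2 \<Longrightarrow> j \<in> {0, 1} \<Longrightarrow>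
     btree_step B (t, p @ [j]) (btree_put t p (BNode (us1 @ k # us2) (vs1 @ vs2)), p)"
| rotate:
    "btree_sub t p = BNode (ks1 @ ks2) (ts1 @ BNode us vs # ts2) \<Longrightarrow>
     length ts1 = length ks1 \<Longrightarrow>
     ks1 @ us @ ks2 = as @ bs @ cs \<Longrightarrow> ts1 @ vs @ ts2 = ds @ es @ fs \<Longrightarrow>
     length ds = length as \<Longrightarrow> length es = length bs + 1 \<Longrightarrow>
     bs \<noteq> [] \<Longrightarrow> bs \<noteq> us \<Longrightarrow> as @ cs \<noteq> [] \<Longrightarrow>
     length bs \<le> B - 1 \<Longrightarrow> length (as @ cs) \<le> B - 1 \<Longrightarrow> q \<in> {p @ [length ds], p} \<Longrightarrow>
     btree_step B (t, p @ [length ts1])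
       (btree_put t p (BNode (as @ cs) (ds @ BNode bs es # fs)), q)"
| rotate_remove:
    "btree_sub t p = BNode (ks1 @ ks2) (ts1 @ BNode us vs # ts2) \<Longrightarrow>
     length ts1 = length ks1 \<Longrightarrow> length (ks1 @ us @ ks2) \<le> B - 1 \<Longrightarrow>
     btree_step B (t, p @ [length ts1])
       (btree_put t p (BNode (ks1 @ us @ ks2) (ts1 @ vs @ ts2)), p)"

definition btree_costs :: "nat \<Rightarrow> nat \<Rightarrow> nat list \<Rightarrow> nat set" where
  "btree_costs B N X =
     {c. \<exists>t t'. is_btree B t \<and> btree_keys t = {1..N} \<and>
           serves (btree_step B) btree_node_keys X t t' c}"

definition opt_btree :: "nat \<Rightarrow> nat \<Rightarrow> nat list \<Rightarrow> nat" where
  "opt_btree B N X = Inf (btree_costs B N X)"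


section \<open>The optima are attained\<close>

lemma serves_static:
  assumes "\<And>x. x \<in> set X \<Longrightarrow> \<exists>i q. (step ^^ i) (t, []) (t, q) \<and> x \<in> node_keys (t, q)"
  shows "\<exists>c. serves step node_keys X t t c"
  using assms
proof (induction X)
  case (Cons x X)
  then obtain c where c: "serves step node_keys X t t c" by auto
  from Cons.prems[of x] obtain i q where iq: "(step ^^ i) (t, []) (t, q)" "x \<in> node_keys (t, q)"
    by auto
  have "serves1 step node_keys x t t (1 + i + 0)"
    unfolding serves1_def using iq by (metis relpowp_0_I)
  with c show ?case by fastforce
qed auto

lemma bst_reach:
  assumes "bst_sub t p = s" "x \<in> set_tree s"
  shows "\<exists>i q. (bst_step ^^ i) (t, p) (t, q) \<and> x \<in> bst_node_keys (t, q)"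
  using assms
proof (induction s arbitrary: p)
  case (Node l k r)
  have sub: "bst_sub t (p @ q) = bst_sub (bst_sub t p) q" for t :: "nat tree" and p q
    by (induction t p rule: bst_sub.induct) (cases q; auto)+
  consider "x = k" | "x \<in> set_tree l" | "x \<in> set_tree r" using Node.prems by auto
  then show ?case
  proof cases
    case 1
    then show ?thesis using Node.prems by (intro exI[of _ 0] exI[of _ p]) auto
  next
    case 2
    then have "bst_step (t, p) (t, p @ [L])" using Node.prems by (intro bst_step.left) auto
    moreover obtain i q where "(bst_step ^^ i) (t, p @ [L]) (t, q)" "x \<in> bst_node_keys (t, q)"
      using Node.IH(1)[of "p @ [L]"] 2 Node.prems sub by auto
    ultimately show ?thesis by (metis relpowp_Suc_I2)
  next
    case 3
    then have "bst_step (t, p) (t, p @ [R])" using Node.prems by (intro bst_step.right) auto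
    moreover obtain i q where "(bst_step ^^ i) (t, p @ [R]) (t, q)" "x \<in> bst_node_keys (t, q)"
      using Node.IH(2)[of "p @ [R]"] 3 Node.prems sub by auto
    ultimately show ?thesis by (metis relpowp_Suc_I2)
  qed
qed simp

lemma btree_reach:
  assumes "btree_sub t p = s" "x \<in> btree_keys s"
  shows "\<exists>i q. (btree_step B ^^ i) (t, p) (t, q) \<and> x \<in> btree_node_keys (t, q)"
  using assms
proof (induction s arbitrary: p)
  case (BNode ks ts)
  have sub: "btree_sub t (p @ q) = btree_sub (btree_sub t p) q" for t p q
    by (induction t p rule: btree_sub.induct) (cases q; auto)+
  show ?case
  proof (cases "x \<in> set ks")
    case True
    then show ?thesis using BNode.prems by (intro exI[of _ 0] exI[of _ p]) auto
  next
    case False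
    then obtain j where j: "j < length ts" "x \<in> btree_keys (ts ! j)"
      using BNode.prems by (auto simp: in_set_conv_nth)
    then have "btree_step B (t, p) (t, p @ [j])"
      using BNode.prems by (intro btree_step.child) auto
    moreover obtain i q where "(btree_step B ^^ i) (t, p @ [j]) (t, q)" "x \<in> btree_node_keys (t, q)"
      using BNode.IH[of "ts ! j" "p @ [j]"] j BNode.prems sub by auto
    ultimately show ?thesis by (metis relpowp_Suc_I2)
  qed
qed simp

lemma opt_bst_attained:
  assumes "set X \<subseteq> {1..N}"
  shows "opt_bst N X \<in> bst_costs N X"
proof -
  have "\<exists>t. bst t \<and> set_tree t = {1..N}"
  proof (induction N)
    case (Suc N)
    then obtain t where "bst t" "set_tree t = {1..N}" by blast
    then show ?case by (intro exI[of _ "Node t (Suc N) Leaf"]) auto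
  qed (auto intro: exI[of _ Leaf])
  then obtain t where t: "bst t" "set_tree t = {1..N}" by blast
  have "\<exists>c. serves bst_step bst_node_keys X t t c"
    by (rule serves_static, rule bst_reach) (use t assms in auto)
  with t have "bst_costs N X \<noteq> {}" by (auto simp: bst_costs_def)
  then show ?thesis unfolding opt_bst_def by (rule Inf_nat_def1)
qed

lemma opt_btree_attained:
  assumes "B \<ge> 2" "set X \<subseteq> {1..N}"
  shows "opt_btree B N X \<in> btree_costs B N X"
proof -
  have "\<exists>t. is_btree B t \<and> btree_keys t = {1..N}"
  proof (induction N)
    case (Suc N)
    then obtain t where "is_btree B t" "btree_keys t = {1..N}" by blast
    then show ?case
      using assms by (intro exI[of _ "BNode [Suc N] [t, Null]"]) (auto simp: less_Suc_eq)
  qed (auto intro: exI[of _ Null])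
  then obtain t where t: "is_btree B t" "btree_keys t = {1..N}" by blast
  have "\<exists>c. serves (btree_step B) btree_node_keys X t t c"
    by (rule serves_static, rule btree_reach) (use t assms in auto)
  with t have "btree_costs B N X \<noteq> {}" by (auto simp: btree_costs_def)
  then show ?thesis unfolding opt_btree_def by (rule Inf_nat_def1)
qed

end

theory Submission
  imports Defs
begin

text \<open>
  Represent every B-tree node by an AVL tree on its keys, of height \<open>O(log B)\<close>, with the
  representations of its children hanging below it.  AVL trees can be split at a key and joined by
  \<open>O(log B)\<close> rotations and pointer moves.  Hence a contiguous interval of the keys of a node can
  be turned into a child, and a child can be absorbed into its parent, at cost \<open>O(log B)\<close>, and
  every B-tree operation is a composition of at most three such transformations and pointer moves
  across AVL trees.
\<close>

section \<open>Simulating one model of search in another\<close>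

definition steps_le :: "('a \<Rightarrow> 'a \<Rightarrow> bool) \<Rightarrow> nat \<Rightarrow> 'a \<Rightarrow> 'a \<Rightarrow> bool" where
  "steps_le r c x y \<longleftrightarrow> (\<exists>n\<le>c. (r ^^ n) x y)"

lemma steps_le_refl: "steps_le r c x x"
  unfolding steps_le_def by (intro exI[of _ 0]) auto

lemma steps_le_step: "r x y \<Longrightarrow> steps_le r 1 x y"
  unfolding steps_le_def by (intro exI[of _ 1]) (auto simp: relpowp_1)

lemma steps_le_trans: "steps_le r a x y \<Longrightarrow> steps_le r b y z \<Longrightarrow> a + b \<le> c \<Longrightarrow> steps_le r c x z"
  unfolding steps_le_def by (meson add_mono order_trans relpowp_trans)

lemma steps_le_mono: "steps_le r a x y \<Longrightarrow> a \<le> b \<Longrightarrow> steps_le r b x y"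
  unfolding steps_le_def by (meson order_trans)

lemma relpowp_simulation:
  assumes step: "\<And>x x' y. r x x' \<Longrightarrow> sim x y \<Longrightarrow> \<exists>y'. sim x' y' \<and> steps_le s k y y'"
    and "(r ^^ n) x x'" "sim x y"
  shows "\<exists>y'. sim x' y' \<and> steps_le s (n * k) y y'"
  using assms(2)
proof (induction n arbitrary: x')
  case 0
  then show ?case using \<open>sim x y\<close> steps_le_refl[of s 0 y] by auto
next
  case (Suc n)
  then obtain x1 where "(r ^^ n) x x1" "r x1 x'" by auto
  then obtain y1 where y1: "sim x1 y1" "steps_le s (n * k) y y1" using Suc.IH by blast
  obtain y' where y': "sim x' y'" "steps_le s k y1 y'" using step \<open>r x1 x'\<close> y1(1) by blast
  have "steps_le s (Suc n * k) y y'" using y1(2) y'(2) by (rule steps_le_trans) simp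
  then show ?case using y'(1) by blast
qed

lemma steps_le_simulation:
  assumes "\<And>x x' y. r x x' \<Longrightarrow> sim x y \<Longrightarrow> \<exists>y'. sim x' y' \<and> steps_le s k y y'"
    and "steps_le r c x x'" "sim x y"
  shows "\<exists>y'. sim x' y' \<and> steps_le s (c * k) y y'"
proof -
  obtain n where "n \<le> c" "(r ^^ n) x x'" using assms(2) by (auto simp: steps_le_def)
  moreover from this obtain y' where "sim x' y'" "steps_le s (n * k) y y'"
    using relpowp_simulation[of r sim s k n x x' y] assms(1,3) by blast
  ultimately show ?thesis by (meson mult_le_mono1 steps_le_mono)
qed

locale search_simulation =
  fixes step1 :: "('t, 'd) config \<Rightarrow> ('t, 'd) config \<Rightarrow> bool" and keys1 :: "('t, 'd) config \<Rightarrow> nat set"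
    and step2 :: "('u, 'e) config \<Rightarrow> ('u, 'e) config \<Rightarrow> bool" and keys2 :: "('u, 'e) config \<Rightarrow> nat set"
    and sim :: "('t, 'd) config \<Rightarrow> ('u, 'e) config \<Rightarrow> bool"
    and step_cost touch_cost :: nat
  assumes simulates_step:
      "step1 x x' \<Longrightarrow> sim x y \<Longrightarrow> \<exists>y'. sim x' y' \<and> steps_le step2 step_cost y y'"
    and simulates_touch:
      "sim x y \<Longrightarrow> a \<in> keys1 x \<Longrightarrow>
        \<exists>y'. a \<in> keys2 y' \<and> steps_le step2 touch_cost y y' \<and> steps_le step2 touch_cost y' y"
    and simulates_reset: "sim (T, p) (t, q) \<Longrightarrow> sim (T, []) (t, [])"
begin

lemma simulates_steps:
  assumes "(step1 ^^ n) x x'" "sim x y"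
  shows "\<exists>y'. sim x' y' \<and> steps_le step2 (n * step_cost) y y'"
  by (rule relpowp_simulation) (use assms simulates_step in blast)+

lemma simulates_serves1:
  assumes "serves1 step1 keys1 a T T' c" "sim (T, []) (t, [])"
  shows "\<exists>t' c'. sim (T', []) (t', []) \<and> serves1 step2 keys2 a t t' c' \<and>
    c' \<le> c * (1 + step_cost + 2 * touch_cost)"
proof -
  obtain i j x p' where x: "(step1 ^^ i) (T, []) x" "a \<in> keys1 x" "(step1 ^^ j) x (T', p')"
    and c: "c = 1 + i + j"
    using assms(1) unfolding serves1_def by metis
  obtain y where y: "sim x y" "steps_le step2 (i * step_cost) (t, []) y"
    using simulates_steps[OF x(1) assms(2)] by blast
  obtain t' q' where t': "sim (T', p') (t', q')" "steps_le step2 (j * step_cost) y (t', q')"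
    using simulates_steps[OF x(3) y(1)] by force
  obtain z where z: "a \<in> keys2 z" "steps_le step2 touch_cost y z" "steps_le step2 touch_cost z y"
    using simulates_touch[OF y(1) x(2)] by blast
  obtain m where m: "(step2 ^^ m) (t, []) z" "m \<le> i * step_cost + touch_cost"
    using steps_le_trans[OF y(2) z(2) order_refl] unfolding steps_le_def by blast
  obtain n where n: "(step2 ^^ n) z (t', q')" "n \<le> touch_cost + j * step_cost"
    using steps_le_trans[OF z(3) t'(2) order_refl] unfolding steps_le_def by blast
  have "serves1 step2 keys2 a t t' (1 + m + n)"
    unfolding serves1_def using m(1) n(1) z(1) by blast
  moreover have "1 + m + n \<le> c * (1 + step_cost + 2 * touch_cost)"
    using m(2) n(2) unfolding c by (simp add: algebra_simps)
  ultimately show ?thesis using simulates_reset[OF t'(1)] by blast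
qed

lemma simulates_serves:
  assumes "serves step1 keys1 X T T' c" "sim (T, []) (t, [])"
  shows "\<exists>t' c'. serves step2 keys2 X t t' c' \<and> c' \<le> c * (1 + step_cost + 2 * touch_cost)"
  using assms
proof (induction X arbitrary: T t c)
  case Nil
  then show ?case by auto
next
  case (Cons a X)
  then obtain T1 c1 c2 where T1: "serves1 step1 keys1 a T T1 c1" "serves step1 keys1 X T1 T' c2"
    and c: "c = c1 + c2" by auto
  obtain t1 d1 where t1: "sim (T1, []) (t1, [])" "serves1 step2 keys2 a t t1 d1"
    "d1 \<le> c1 * (1 + step_cost + 2 * touch_cost)"
    using simulates_serves1[OF T1(1) Cons.prems(2)] by blast
  obtain t' d2 where t': "serves step2 keys2 X t1 t' d2"
    "d2 \<le> c2 * (1 + step_cost + 2 * touch_cost)"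
    using Cons.IH[OF T1(2) t1(1)] by blast
  have "d1 + d2 \<le> c * (1 + step_cost + 2 * touch_cost)"
    unfolding c add_mult_distrib using t1(3) t'(2) by (rule add_mono)
  moreover have "serves step2 keys2 (a # X) t t' (d1 + d2)"
    using t1(2) t'(1) by auto
  ultimately show ?case by blast
qed

end


section \<open>Pointer moves in a BST\<close>

lemma bst_sub_append: "bst_sub t (p @ q) = bst_sub (bst_sub t p) q"
  by (induction t p rule: bst_sub.induct) (cases q; auto)+

lemma bst_put_sub: "bst_put t p (bst_sub t p) = t"
  by (induction t p rule: bst_sub.induct) auto

lemma bst_put_append: "bst_put t (p @ q) s = bst_put t p (bst_put (bst_sub t p) q s)"
  by (induction t p rule: bst_sub.induct) auto

lemma bst_put_put: "bst_put (bst_put t p s) p s' = bst_put t p s'"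
  by (induction t p s rule: bst_put.induct) auto

lemma bst_sub_put: "(bst_sub t p = Leaf \<Longrightarrow> s = Leaf) \<Longrightarrow> bst_sub (bst_put t p s) p = s"
  by (induction t p rule: bst_sub.induct) auto

lemma bst_step_context:
  "bst_step (bst_sub t p, q) (s', q') \<Longrightarrow> bst_step (t, p @ q) (bst_put t p s', p @ q')"
proof (induction "(bst_sub t p, q)" "(s', q')" rule: bst_step.induct)
  case left
  then show ?case using bst_step.left[of t "p @ q"] by (auto simp: bst_sub_append bst_put_sub)
next
  case right
  then show ?case using bst_step.right[of t "p @ q"] by (auto simp: bst_sub_append bst_put_sub)
next
  case parent
  then show ?case using bst_step.parent[of t "p @ q'"] by (auto simp: bst_put_sub)
next
  case rotate_left_child
  then show ?case
    using bst_step.rotate_left_child[of t "p @ q'"] by (auto simp: bst_sub_append bst_put_append)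
next
  case rotate_right_child
  then show ?case
    using bst_step.rotate_right_child[of t "p @ q'"] by (auto simp: bst_sub_append bst_put_append)
qed

lemma bst_step_Leaf: "bst_step (Leaf, q) (s', q') \<Longrightarrow> s' = Leaf"
proof -
  have "bst_sub Leaf p = Leaf" for p by (cases p) auto
  then show "bst_step (Leaf, q) (s', q') \<Longrightarrow> s' = Leaf" by (auto elim: bst_step.cases)
qed

lemma steps_le_bst_context:
  assumes "steps_le bst_step c (bst_sub t p, q) (s', q')"
  shows "steps_le bst_step c (t, p @ q) (bst_put t p s', p @ q')"
proof -
  define sim where "sim = (\<lambda>(s, q) y. (bst_sub t p = Leaf \<longrightarrow> s = Leaf) \<and> y = (bst_put t p s, p @ q))"
  have step: "\<exists>y'. sim x' y' \<and> steps_le bst_step 1 y y'" if "bst_step x x'" "sim x y" for x x' y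
  proof -
    obtain s q s' q' where x: "x = (s, q)" "x' = (s', q')" by fastforce
    have s: "bst_sub (bst_put t p s) p = s" using \<open>sim x y\<close> bst_sub_put by (auto simp: sim_def x)
    then have "bst_step y (bst_put t p s', p @ q')"
      using bst_step_context[of "bst_put t p s" p q s' q'] that
      by (auto simp: sim_def x bst_put_put)
    moreover have "sim x' (bst_put t p s', p @ q')"
      using that bst_step_Leaf by (auto simp: sim_def x)
    ultimately show ?thesis by (blast intro: steps_le_step)
  qed
  show ?thesis
    using steps_le_simulation[where sim = sim and y = "(t, p @ q)", OF step assms]
    by (simp add: sim_def bst_put_sub)
qed

lemma steps_le_ascend: "steps_le bst_step (length q) (t, p @ q) (t, p)"
proof (induction q rule: rev_induct)
  case (snoc d q)
  have "bst_step (t, (p @ q) @ [d]) (t, p @ q)" by (rule bst_step.parent)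
  with snoc show ?case by (auto intro: steps_le_trans[OF steps_le_step])
qed (simp add: steps_le_refl)

lemma steps_le_descend: "bst_sub t q \<noteq> Leaf \<Longrightarrow> steps_le bst_step (length q) (t, []) (t, q)"
proof (induction q rule: rev_induct)
  case (snoc d q)
  then obtain l k r where sub: "bst_sub t q = Node l k r"
    by (cases "bst_sub t q") (auto simp: bst_sub_append)
  then have "bst_step (t, q) (t, q @ [d])"
    using snoc.prems by (cases d) (auto simp: bst_sub_append intro: bst_step.left bst_step.right)
  with snoc sub show ?case by (auto intro: steps_le_trans[OF _ steps_le_step])
qed (simp add: steps_le_refl)

lemma steps_le_subtree:
  assumes "steps_le bst_step c (bst_sub t p, []) (s', [])"
  shows "steps_le bst_step (c + 2 * length p) (t, []) (bst_put t p s', [])"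
proof (cases "bst_sub t p = Leaf")
  case True
  have "fst y = Leaf" if "(bst_step ^^ n) (Leaf, []) y" for n y
    using that
  proof (induction n arbitrary: y)
    case (Suc n)
    then obtain q where "bst_step (Leaf, q) y" by (metis prod.collapse relpowp_Suc_E)
    then show ?case using bst_step_Leaf by (cases y) auto
  qed auto
  then have "s' = bst_sub t p" using assms True by (fastforce simp: steps_le_def)
  then show ?thesis by (simp add: bst_put_sub steps_le_refl)
next
  case False
  have "steps_le bst_step (length p) (t, []) (t, p)" using False by (rule steps_le_descend)
  moreover have "steps_le bst_step c (t, p) (bst_put t p s', p)"
    using steps_le_bst_context[OF assms] by simp
  ultimately have "steps_le bst_step (length p + c) (t, []) (bst_put t p s', p)"
    by (rule steps_le_trans) simp
  moreover have "steps_le bst_step (length p) (bst_put t p s', p) (bst_put t p s', [])"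
    using steps_le_ascend[of p _ "[]"] by simp
  ultimately show ?thesis by (rule steps_le_trans) simp
qed


section \<open>Rotations inside a binary tree\<close>

text \<open>The cost includes the pointer moves from the root to the rotated edges and back.\<close>

inductive rotates :: "nat \<Rightarrow> 'a tree \<Rightarrow> 'a tree \<Rightarrow> bool" where
  refl: "rotates c t t"
| rotate_right: "rotates 2 \<langle>\<langle>a, x, b\<rangle>, y, c\<rangle> \<langle>a, x, \<langle>b, y, c\<rangle>\<rangle>"
| rotate_left: "rotates 2 \<langle>a, x, \<langle>b, y, c\<rangle>\<rangle> \<langle>\<langle>a, x, b\<rangle>, y, c\<rangle>"
| left_subtree: "rotates c l l' \<Longrightarrow> rotates (c + 2) \<langle>l, x, r\<rangle> \<langle>l', x, r\<rangle>"
| right_subtree: "rotates c r r' \<Longrightarrow> rotates (c + 2) \<langle>l, x, r\<rangle> \<langle>l, x, r'\<rangle>"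
| trans: "rotates a s t \<Longrightarrow> rotates b t u \<Longrightarrow> a + b \<le> c \<Longrightarrow> rotates c s u"

lemma rotates_mono: "rotates a s t \<Longrightarrow> a \<le> b \<Longrightarrow> rotates b s t"
  using rotates.trans[OF _ rotates.refl[of 0]] by simp

lemma rotates_mirror: "rotates c s t \<Longrightarrow> rotates c (mirror s) (mirror t)"
  by (induction rule: rotates.induct) (auto intro: rotates.intros)

lemma rotates_inorder: "rotates c s t \<Longrightarrow> inorder t = inorder s"
  by (induction rule: rotates.induct) auto

lemma rotates_size1: "rotates c s t \<Longrightarrow> size1 t = size1 s"
  by (metis length_inorder rotates_inorder size1_size)

lemma rotates_steps_le: "rotates c s t \<Longrightarrow> steps_le bst_step c (s, []) (t, [])"
proof (induction rule: rotates.induct)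
  case (rotate_right a x b y c)
  let ?t = "\<langle>\<langle>a, x, b\<rangle>, y, c\<rangle>"
  have "bst_step (?t, []) (?t, [] @ [L])" by (rule bst_step.left) auto
  moreover have "bst_step (?t, [] @ [L]) (bst_put ?t [] \<langle>a, x, \<langle>b, y, c\<rangle>\<rangle>, [])"
    by (rule bst_step.rotate_left_child) auto
  ultimately show ?case by (intro steps_le_trans[OF steps_le_step steps_le_step]) auto
next
  case (rotate_left a x b y c)
  let ?t = "\<langle>a, x, \<langle>b, y, c\<rangle>\<rangle>"
  have "bst_step (?t, []) (?t, [] @ [R])" by (rule bst_step.right) auto
  moreover have "bst_step (?t, [] @ [R]) (bst_put ?t [] \<langle>\<langle>a, x, b\<rangle>, y, c\<rangle>, [])"
    by (rule bst_step.rotate_right_child) auto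
  ultimately show ?case by (intro steps_le_trans[OF steps_le_step steps_le_step]) auto
next
  case (left_subtree c l l' x r)
  then show ?case using steps_le_subtree[of c "\<langle>l, x, r\<rangle>" "[L]"] by simp
next
  case (right_subtree c r r' l x)
  then show ?case using steps_le_subtree[of c "\<langle>l, x, r\<rangle>" "[R]"] by simp
qed (auto intro: steps_le_refl steps_le_trans)


section \<open>AVL trees\<close>

fun avl :: "'a tree \<Rightarrow> bool" where
  "avl \<langle>\<rangle> \<longleftrightarrow> True"
| "avl \<langle>l, _, r\<rangle> \<longleftrightarrow> avl l \<and> avl r \<and> height l \<le> height r + 1 \<and> height r \<le> height l + 1"

lemma avl_mirror: "avl (mirror t) \<longleftrightarrow> avl t"
  by (induction t) auto

lemma avl_height_le_size1: "avl t \<Longrightarrow> 2 ^ height t \<le> (size1 t)\<^sup>2"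
proof (induction t)
  case (Node l x r)
  show ?case
  proof (cases "l = Leaf \<and> r = Leaf")
    case False
    define m where "m = max (height l) (height r) - 1"
    have m: "height \<langle>l, x, r\<rangle> = m + 2" "m \<le> height l" "m \<le> height r"
      using False Node.prems by (auto simp: m_def max_def neq_Leaf_iff)
    have le: "2 ^ m \<le> (size1 l)\<^sup>2" "2 ^ m \<le> (size1 r)\<^sup>2"
      using Node m(2,3) by (auto intro: order_trans[OF power_increasing])
    then have "(2 ^ m)\<^sup>2 \<le> (size1 l * size1 r)\<^sup>2"
      unfolding power_mult_distrib power2_eq_square[of "2 ^ m"] by (rule mult_mono) auto
    then have "2 ^ m \<le> size1 l * size1 r" by (rule power2_le_imp_le) simp
    then have "4 * 2 ^ m \<le> (size1 l + size1 r)\<^sup>2" using le by (simp add: power2_sum)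
    then show ?thesis unfolding m by (simp add: power_add)
  qed auto
qed simp

lemma avl_rebalance:
  assumes "avl l" "avl r" "height r = height l + 2"
  shows "\<exists>t. avl t \<and> rotates 6 \<langle>l, x, r\<rangle> t \<and> height r \<le> height t \<and> height t \<le> height r + 1"
proof -
  obtain b y d where r: "r = \<langle>b, y, d\<rangle>" using assms(3) by (cases r) auto
  show ?thesis
  proof (cases "height b \<le> height d")
    case True
    have "rotates 6 \<langle>l, x, r\<rangle> \<langle>\<langle>l, x, b\<rangle>, y, d\<rangle>"
      unfolding r by (rule rotates_mono[OF rotates.rotate_left]) simp
    then show ?thesis using assms True unfolding r by (intro exI[of _ "\<langle>\<langle>l, x, b\<rangle>, y, d\<rangle>"]) auto
  next
    case False
    then obtain e z f where b: "b = \<langle>e, z, f\<rangle>" by (cases b) auto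
    have "rotates 6 \<langle>l, x, r\<rangle> \<langle>\<langle>l, x, e\<rangle>, z, \<langle>f, y, d\<rangle>\<rangle>"
      unfolding r b
      by (rule rotates.trans[OF rotates.right_subtree[OF rotates.rotate_right] rotates.rotate_left])
        simp
    then show ?thesis using assms False unfolding r b
      by (intro exI[of _ "\<langle>\<langle>l, x, e\<rangle>, z, \<langle>f, y, d\<rangle>\<rangle>"]) auto
  qed
qed

definition avl_joins :: "'a tree \<Rightarrow> 'a \<Rightarrow> 'a tree \<Rightarrow> 'a tree \<Rightarrow> bool" where
  "avl_joins l x r t \<longleftrightarrow> avl t \<and>
     rotates (10 * (max (height l) (height r) - min (height l) (height r))) \<langle>l, x, r\<rangle> t \<and>
     max (height l) (height r) \<le> height t \<and> height t \<le> max (height l) (height r) + 1"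

lemma avl_joins_mirror: "avl_joins l x r t \<Longrightarrow> avl_joins (mirror r) x (mirror l) (mirror t)"
  using rotates_mirror[of _ "\<langle>l, x, r\<rangle>" t]
  by (auto simp: avl_joins_def avl_mirror max.commute min.commute)

lemma avl_joins_left_spine:
  assumes "avl \<langle>a, y, b\<rangle>" "height r \<le> height b" "avl_joins b x r t"
  shows "\<exists>u. avl_joins \<langle>a, y, b\<rangle> x r u"
proof -
  let ?l = "\<langle>a, y, b\<rangle>"
  have t: "avl t" "rotates (10 * (height b - height r)) \<langle>b, x, r\<rangle> t"
    "height b \<le> height t" "height t \<le> height b + 1"
    using assms(2,3) by (auto simp: avl_joins_def max_absorb1 min_absorb2)
  have descend: "rotates (10 * (height b - height r) + 4) \<langle>?l, x, r\<rangle> \<langle>a, y, t\<rangle>"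
    by (rule rotates.trans[OF rotates.rotate_right rotates.right_subtree[OF t(2)]]) simp
  have joins: "avl_joins ?l x r u"
    if "avl u" "rotates 6 \<langle>a, y, t\<rangle> u" "height ?l \<le> height u" "height u \<le> height ?l + 1" for u
  proof -
    have "10 * (height b - height r) + 10 \<le> 10 * (height ?l - height r)" using assms(2) by auto
    then have "rotates (10 * (height ?l - height r)) \<langle>?l, x, r\<rangle> u"
      by (intro rotates.trans[OF descend that(2)]) simp
    then show ?thesis using that assms(2) by (simp add: avl_joins_def max_absorb1 min_absorb2)
  qed
  show ?thesis
  proof (cases "height t \<le> height a + 1")
    case True
    then have "avl_joins ?l x r \<langle>a, y, t\<rangle>"
      using assms(1) t by (intro joins rotates.refl) auto
    then show ?thesis by blast
  next
    case False
    then have heights: "height t = height a + 2" "height b = height a + 1" using t assms(1) by auto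
    then obtain u where
      "avl u" "rotates 6 \<langle>a, y, t\<rangle> u" "height t \<le> height u" "height u \<le> height t + 1"
      using avl_rebalance[OF _ t(1)] assms(1) by auto
    then have "avl_joins ?l x r u" using heights by (intro joins) auto
    then show ?thesis by blast
  qed
qed

lemma avl_join_left:
  assumes "avl l" "avl r" "height r \<le> height l + 1"
  shows "\<exists>t. avl_joins l x r t"
  using assms(1,3)
proof (induction l)
  case Leaf
  then show ?case using assms(2) rotates.refl
    by (intro exI[of _ "\<langle>\<langle>\<rangle>, x, r\<rangle>"]) (auto simp: avl_joins_def)
next
  case (Node a y b)
  let ?l = "\<langle>a, y, b\<rangle>"
  show ?case
  proof (cases "height ?l \<le> height r + 1")
    case True
    then show ?thesis using Node.prems assms(2) rotates.refl
      by (intro exI[of _ "\<langle>?l, x, r\<rangle>"]) (auto simp: avl_joins_def)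
  next
    case False
    then have "height r \<le> height b" using Node.prems by auto
    moreover from this obtain t where "avl_joins b x r t" using Node.IH(2) Node.prems by auto
    ultimately show ?thesis using avl_joins_left_spine[OF Node.prems(1)] by blast
  qed
qed

lemma avl_join:
  assumes "avl l" "avl r"
  shows "\<exists>t. avl_joins l x r t"
proof (cases "height r \<le> height l")
  case True
  then show ?thesis using avl_join_left[OF assms] by simp
next
  case False
  then obtain t where "avl_joins (mirror r) x (mirror l) t"
    using avl_join_left[of "mirror r" "mirror l"] assms by (auto simp: avl_mirror)
  then show ?thesis using avl_joins_mirror by force
qed

lemma avl_exists: "\<exists>t. avl t \<and> inorder t = xs"
proof (induction xs)
  case Nil
  then show ?case by (intro exI[of _ "\<langle>\<rangle>"]) simp
next
  case (Cons x xs)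
  then obtain r where "avl r" "inorder r = xs" by blast
  moreover from this obtain t where "avl_joins \<langle>\<rangle> x r t" using avl_join[of "\<langle>\<rangle>" r] by auto
  ultimately show ?case using rotates_inorder[of _ "\<langle>\<langle>\<rangle>, x, r\<rangle>" t] by (auto simp: avl_joins_def)
qed

text \<open>The cost of each join on the way up is paid for by the increase of the heights of the two
  parts, so that the total is linear in the height of the tree.\<close>

definition avl_splits :: "'a tree \<Rightarrow> 'a tree \<Rightarrow> 'a \<Rightarrow> 'a tree \<Rightarrow> bool" where
  "avl_splits t l x r \<longleftrightarrow> avl l \<and> avl r \<and> height l \<le> height t \<and> height r \<le> height t \<and>
     rotates (10 * (height l + height r) + 16 * height t) t \<langle>l, x, r\<rangle>"

lemma avl_splits_mirror: "avl_splits t l x r \<Longrightarrow> avl_splits (mirror t) (mirror r) x (mirror l)"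
  using rotates_mirror[of _ t "\<langle>l, x, r\<rangle>"] by (simp add: avl_splits_def avl_mirror add.commute)

lemma avl_splits_left_subtree:
  assumes "avl \<langle>a, y, b\<rangle>" "avl_splits a l x r"
  shows "\<exists>r'. avl_splits \<langle>a, y, b\<rangle> l x r'"
proof -
  obtain t where t: "avl_joins r y b t"
    using assms avl_join[of r b] by (auto simp: avl_splits_def)
  have "rotates (10 * (height l + height r) + 16 * height a + 2) \<langle>a, y, b\<rangle> \<langle>\<langle>l, x, r\<rangle>, y, b\<rangle>"
    by (rule rotates.left_subtree) (use assms(2) in \<open>simp add: avl_splits_def\<close>)
  then have "rotates (10 * (height l + height r) + 16 * height a + 4) \<langle>a, y, b\<rangle> \<langle>l, x, \<langle>r, y, b\<rangle>\<rangle>"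
    by (rule rotates.trans[OF _ rotates.rotate_right]) simp
  moreover have "rotates (10 * (max (height r) (height b) - min (height r) (height b)) + 2)
      \<langle>l, x, \<langle>r, y, b\<rangle>\<rangle> \<langle>l, x, t\<rangle>"
    by (rule rotates.right_subtree) (use t in \<open>simp add: avl_joins_def\<close>)
  moreover have "10 * (height l + height r) + 16 * height a + 4 +
      (10 * (max (height r) (height b) - min (height r) (height b)) + 2)
      \<le> 10 * (height l + height t) + 16 * height \<langle>a, y, b\<rangle>"
    using assms t by (auto simp: avl_splits_def avl_joins_def max_def min_def)
  ultimately have "rotates (10 * (height l + height t) + 16 * height \<langle>a, y, b\<rangle>) \<langle>a, y, b\<rangle> \<langle>l, x, t\<rangle>"
    by (rule rotates.trans)
  then show ?thesis using assms t by (intro exI[of _ t]) (auto simp: avl_splits_def avl_joins_def)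
qed

lemma avl_splits_right_subtree:
  assumes "avl \<langle>a, y, b\<rangle>" "avl_splits b l x r"
  shows "\<exists>l'. avl_splits \<langle>a, y, b\<rangle> l' x r"
proof -
  obtain r' where "avl_splits \<langle>mirror b, y, mirror a\<rangle> (mirror r) x r'"
    using avl_splits_left_subtree[of "mirror b" y "mirror a"] avl_splits_mirror assms
    by (fastforce simp: avl_mirror)
  then show ?thesis using avl_splits_mirror by fastforce
qed

lemma avl_split:
  "avl t \<Longrightarrow> inorder t = xs @ x # ys \<Longrightarrow>
    \<exists>l r. avl_splits t l x r \<and> inorder l = xs \<and> inorder r = ys"
proof (induction t arbitrary: xs ys)
  case (Node a y b)
  have inorder: "inorder \<langle>a, y, b\<rangle> = inorder l @ x # inorder r"
    if "avl_splits \<langle>a, y, b\<rangle> l x r" for l r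
    using that rotates_inorder by (fastforce simp: avl_splits_def)
  consider (root) "inorder a = xs" "y = x" "inorder b = ys"
    | (left) zs where "inorder a = xs @ x # zs"
    | (right) zs where "inorder b = zs @ x # ys"
    using Node.prems(2)
    by (auto simp: append_eq_append_conv2 append_eq_Cons_conv Cons_eq_append_conv)
  then show ?case
  proof cases
    case root
    then have "avl_splits \<langle>a, y, b\<rangle> a x b"
      using Node.prems by (auto simp: avl_splits_def intro: rotates.refl)
    then show ?thesis using root by blast
  next
    case left
    then obtain l r where l: "avl_splits a l x r" "inorder l = xs"
      using Node.IH(1)[OF _ left] Node.prems(1) by auto
    then obtain r' where "avl_splits \<langle>a, y, b\<rangle> l x r'"
      using avl_splits_left_subtree[OF Node.prems(1) l(1)] by blast
    then show ?thesis using inorder Node.prems(2) l(2) by fastforce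
  next
    case right
    then obtain l r where r: "avl_splits b l x r" "inorder r = ys"
      using Node.IH(2)[OF _ right] Node.prems(1) by auto
    then obtain l' where "avl_splits \<langle>a, y, b\<rangle> l' x r"
      using avl_splits_right_subtree[OF Node.prems(1) r(1)] by blast
    then show ?thesis using inorder Node.prems(2) r(2) by fastforce
  qed
qed simp


definition avl_height_bound :: "nat \<Rightarrow> nat" where
  "avl_height_bound n = nat \<lfloor>2 * log 2 (real n + 1)\<rfloor>"

lemma avl_height_le_bound:
  assumes "avl t" "size t \<le> n"
  shows "height t \<le> avl_height_bound n"
proof -
  have "2 ^ height t \<le> (size1 t)\<^sup>2" by (rule avl_height_le_size1[OF assms(1)])
  also have "\<dots> \<le> (n + 1)\<^sup>2" using assms(2) by (intro power_mono) (auto simp: size1_size)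
  finally have "real (2 ^ height t) \<le> real ((n + 1)\<^sup>2)" by (simp only: of_nat_le_iff)
  then have "log 2 (2 ^ height t) \<le> log 2 ((real n + 1)\<^sup>2)"
    by (subst log_le_cancel_iff) (auto simp: add.commute)
  also have "log 2 (2 ^ height t) = real (height t)" by simp
  also have "log 2 ((real n + 1)\<^sup>2) = 2 * log 2 (real n + 1)" by (subst log_nat_power) auto
  finally show ?thesis unfolding avl_height_bound_def by (rule le_nat_floor)
qed

lemma avl_height_bound_ge_2: "1 \<le> n \<Longrightarrow> 2 \<le> avl_height_bound n"
  unfolding avl_height_bound_def by (intro le_nat_floor) (simp add: le_log_iff)


section \<open>Grafting trees onto the leaves of a tree\<close>

fun graft :: "'a tree \<Rightarrow> 'a tree list \<Rightarrow> 'a tree" where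
  "graft \<langle>\<rangle> us = hd us"
| "graft \<langle>l, x, r\<rangle> us = \<langle>graft l (take (size1 l) us), x, graft r (drop (size1 l) us)\<rangle>"

fun leaf_path :: "'a tree \<Rightarrow> nat \<Rightarrow> dir list" where
  "leaf_path \<langle>\<rangle> i = []"
| "leaf_path \<langle>l, x, r\<rangle> i =
     (if i < size1 l then L # leaf_path l i else R # leaf_path r (i - size1 l))"

lemma length_leaf_path: "length (leaf_path s i) \<le> height s"
  by (induction s arbitrary: i) (auto simp: le_max_iff_disj)

lemma bst_sub_graft_leaf_path:
  "length us = size1 s \<Longrightarrow> i < size1 s \<Longrightarrow> bst_sub (graft s us) (leaf_path s i) = us ! i"
  by (induction s arbitrary: i us) (auto simp: length_Suc_conv)

lemma bst_put_graft_leaf_path: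
  "length us = size1 s \<Longrightarrow> i < size1 s \<Longrightarrow>
    bst_put (graft s us) (leaf_path s i) u = graft s (us[i := u])"
  by (induction s arbitrary: i us)
    (auto simp: take_update_swap drop_update_swap list_update_beyond length_Suc_conv)

lemma graft_key_path:
  "x \<in> set_tree s \<Longrightarrow> \<exists>p l r. length p \<le> height s \<and> bst_sub (graft s us) p = \<langle>l, x, r\<rangle>"
proof (induction s arbitrary: us)
  case (Node a y b)
  then consider "x = y" | "x \<in> set_tree a" | "x \<in> set_tree b" by auto
  then show ?case
  proof cases
    case 1
    then show ?thesis by (intro exI[of _ "[]"]) auto
  next
    case 2
    then obtain p l r where "length p \<le> height a"
      "bst_sub (graft a (take (size1 a) us)) p = \<langle>l, x, r\<rangle>"
      using Node.IH(1) by blast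
    then show ?thesis by (intro exI[of _ "L # p"]) auto
  next
    case 3
    then obtain p l r where "length p \<le> height b"
      "bst_sub (graft b (drop (size1 a) us)) p = \<langle>l, x, r\<rangle>"
      using Node.IH(2) by blast
    then show ?thesis by (intro exI[of _ "R # p"]) auto
  qed
qed simp

lemma set_tree_graft:
  "length us = size1 s \<Longrightarrow> set_tree (graft s us) = set_tree s \<union> (\<Union>u \<in> set us. set_tree u)"
proof (induction s arbitrary: us)
  case (Node l x r)
  have "set us = set (take (size1 l) us) \<union> set (drop (size1 l) us)"
    by (metis append_take_drop_id set_append)
  then show ?case using Node by auto
qed (auto simp: length_Suc_conv)

definition separates :: "'a::linorder list \<Rightarrow> 'a set list \<Rightarrow> bool" where
  "separates ks Xs \<longleftrightarrow> (\<forall>i < length Xs. \<forall>x \<in> Xs ! i.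
     (0 < i \<longrightarrow> ks ! (i - 1) < x) \<and> (i < length ks \<longrightarrow> x < ks ! i))"

lemma separatesD:
  assumes "separates ks Xs" "i < length Xs" "x \<in> Xs ! i"
  shows "0 < i \<Longrightarrow> ks ! (i - 1) < x" "i < length ks \<Longrightarrow> x < ks ! i"
  using assms by (auto simp: separates_def)

lemma separates_append:
  assumes "separates (ks1 @ k # ks2) (Xs1 @ Xs2)" "length Xs1 = length ks1 + 1"
  shows "separates ks1 Xs1" "separates ks2 Xs2"
proof -
  show "separates ks1 Xs1"
    unfolding separates_def
  proof (intro allI ballI impI conjI)
    fix i x assume "i < length Xs1" "x \<in> Xs1 ! i"
    then show "0 < i \<Longrightarrow> ks1 ! (i - 1) < x" and "i < length ks1 \<Longrightarrow> x < ks1 ! i"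
      using separatesD[OF assms(1), of i x] assms(2) by (auto simp: nth_append split: if_splits)
  qed
  show "separates ks2 Xs2"
    unfolding separates_def
  proof (intro allI ballI impI conjI)
    fix i x assume "i < length Xs2" "x \<in> Xs2 ! i"
    then show "0 < i \<Longrightarrow> ks2 ! (i - 1) < x" and "i < length ks2 \<Longrightarrow> x < ks2 ! i"
      using separatesD[OF assms(1), of "length Xs1 + i" x] assms(2)
      by (auto simp: nth_append nth_Cons')
  qed
qed

lemma separates_append_less:
  assumes "separates (ks1 @ k # ks2) (Xs1 @ Xs2)" "length Xs1 = length ks1 + 1"
    "length Xs2 = length ks2 + 1" "sorted_wrt (<) (ks1 @ k # ks2)"
  shows "X \<in> set Xs1 \<Longrightarrow> x \<in> X \<Longrightarrow> x < k" "X \<in> set Xs2 \<Longrightarrow> x \<in> X \<Longrightarrow> k < x"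
proof -
  let ?ks = "ks1 @ k # ks2"
  have mono: "?ks ! i \<le> ?ks ! j" if "i \<le> j" "j < length ?ks" for i j
    using sorted_nth_mono[OF strict_sorted_imp_sorted[OF assms(4)]] that by blast
  show "x < k" if x: "X \<in> set Xs1" "x \<in> X"
  proof -
    obtain i where "i < length Xs1" "x \<in> Xs1 ! i" using x by (auto simp: in_set_conv_nth)
    then show ?thesis
      using separatesD(2)[OF assms(1), of i x] mono[of i "length ks1"] assms(2)
      by (auto simp: nth_append)
  qed
  show "k < x" if x: "X \<in> set Xs2" "x \<in> X"
  proof -
    obtain i where "i < length Xs2" "x \<in> Xs2 ! i" using x by (auto simp: in_set_conv_nth)
    then show ?thesis
      using separatesD(1)[OF assms(1), of "length Xs1 + i" x]
        mono[of "length ks1" "length ks1 + i"] assms(2,3)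
      by (auto simp: nth_append)
  qed
qed

lemma bst_graft:
  assumes "bst s" "length us = size1 s" "\<And>u. u \<in> set us \<Longrightarrow> bst u"
    "separates (inorder s) (map set_tree us)"
  shows "bst (graft s us)"
  using assms
proof (induction s arbitrary: us)
  case (Node l x r)
  let ?us1 = "take (size1 l) us" and ?us2 = "drop (size1 l) us"
  have "separates (inorder l @ x # inorder r) (map set_tree ?us1 @ map set_tree ?us2)"
    using Node.prems(4) by (simp flip: map_append)
  moreover have "length (map set_tree ?us1) = length (inorder l) + 1"
    "length (map set_tree ?us2) = length (inorder r) + 1"
    using Node.prems(2) by (simp_all add: size1_size)
  moreover have "sorted_wrt (<) (inorder l @ x # inorder r)"
    using bst_iff_sorted_wrt_less[of "\<langle>l, x, r\<rangle>"] Node.prems(1) by simp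
  ultimately have sep: "separates (inorder l) (map set_tree ?us1)"
    "separates (inorder r) (map set_tree ?us2)"
    and less: "\<forall>u \<in> set ?us1. \<forall>y \<in> set_tree u. y < x" "\<forall>u \<in> set ?us2. \<forall>y \<in> set_tree u. x < y"
    using separates_append separates_append_less by (blast, blast, fastforce, fastforce)
  have "bst (graft l ?us1)"
    by (rule Node.IH(1)) (use Node.prems sep(1) in \<open>auto dest: in_set_takeD\<close>)
  moreover have "bst (graft r ?us2)"
    by (rule Node.IH(2)) (use Node.prems sep(2) in \<open>auto dest: in_set_dropD\<close>)
  ultimately show ?case using Node.prems(1,2) less by (auto simp: set_tree_graft)
qed (auto simp: length_Suc_conv)

lemma rotates_graft: "rotates c s t \<Longrightarrow> rotates c (graft s us) (graft t us)"
proof (induction arbitrary: us rule: rotates.induct)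
  case (left_subtree c l l' x r)
  then show ?case
    using rotates.left_subtree[OF left_subtree.IH[of "take (size1 l) us"]] rotates_size1
    by fastforce
next
  case (right_subtree c r r' l x)
  then show ?case using rotates.right_subtree[OF right_subtree.IH[of "drop (size1 l) us"]] by simp
qed (auto simp: drop_take add.commute intro: rotates.intros)

definition avl_graft :: "'a list \<Rightarrow> 'a tree list \<Rightarrow> 'a tree \<Rightarrow> bool" where
  "avl_graft ks us t \<longleftrightarrow>
     length us = length ks + 1 \<and> (\<exists>s. avl s \<and> inorder s = ks \<and> t = graft s us)"

lemma avl_graftI: "avl s \<Longrightarrow> length us = size1 s \<Longrightarrow> avl_graft (inorder s) us (graft s us)"
  by (auto simp: avl_graft_def size1_size)

lemma avl_graft_Nil: "avl_graft [] us t \<longleftrightarrow> us = [t]"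
  by (auto simp: avl_graft_def length_Suc_conv intro: exI[of _ "\<langle>\<rangle>"])

lemma avl_graft_split:
  assumes "avl_graft (ks1 @ k # ks2) (us1 @ us2) t" "length us1 = length ks1 + 1"
    "length (ks1 @ k # ks2) \<le> n"
  shows "\<exists>l r. avl_graft ks1 us1 l \<and> avl_graft ks2 us2 r \<and>
    rotates (36 * avl_height_bound n) t \<langle>l, k, r\<rangle>"
proof -
  obtain s where s: "avl s" "inorder s = ks1 @ k # ks2" "t = graft s (us1 @ us2)"
    and us: "length (us1 @ us2) = length (ks1 @ k # ks2) + 1"
    using assms(1) by (auto simp: avl_graft_def)
  obtain l r where lr: "avl_splits s l k r" "inorder l = ks1" "inorder r = ks2"
    using avl_split[OF s(1,2)] by blast
  have "size1 l = length us1" using assms(2) lr(2) by (metis length_inorder size1_size)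
  then have graft: "graft \<langle>l, k, r\<rangle> (us1 @ us2) = \<langle>graft l us1, k, graft r us2\<rangle>" by simp
  have "height s \<le> avl_height_bound n"
    using avl_height_le_bound[OF s(1)] assms(3) s(2) by (metis length_inorder)
  then have "10 * (height l + height r) + 16 * height s \<le> 36 * avl_height_bound n"
    using lr(1) by (simp add: avl_splits_def)
  with lr(1) have "rotates (36 * avl_height_bound n) s \<langle>l, k, r\<rangle>"
    unfolding avl_splits_def by (blast intro: rotates_mono)
  then have "rotates (36 * avl_height_bound n) t \<langle>graft l us1, k, graft r us2\<rangle>"
    using rotates_graft s(3) graft by metis
  then show ?thesis using lr us assms(2) by (auto simp: avl_graft_def avl_splits_def)
qed

lemma avl_graft_join:
  assumes "avl_graft ks1 us1 l" "avl_graft ks2 us2 r" "length (ks1 @ k # ks2) \<le> n"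
  shows "\<exists>t. avl_graft (ks1 @ k # ks2) (us1 @ us2) t \<and>
    rotates (10 * avl_height_bound n) \<langle>l, k, r\<rangle> t"
proof -
  obtain s1 s2 where s1: "avl s1" "inorder s1 = ks1" "l = graft s1 us1"
    and s2: "avl s2" "inorder s2 = ks2" "r = graft s2 us2"
    and us: "length us1 = length ks1 + 1" "length us2 = length ks2 + 1"
    using assms(1,2) by (auto simp: avl_graft_def)
  obtain s where s: "avl_joins s1 k s2 s" using avl_join[OF s1(1) s2(1)] by blast
  have "size1 s1 = length us1" using s1(2) us(1) by (metis length_inorder size1_size)
  then have graft: "graft \<langle>s1, k, s2\<rangle> (us1 @ us2) = \<langle>l, k, r\<rangle>" using s1 s2 by simp
  have "size s1 \<le> n" "size s2 \<le> n" using assms(3) s1(2) s2(2) by auto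
  then have "height s1 \<le> avl_height_bound n" "height s2 \<le> avl_height_bound n"
    using avl_height_le_bound s1(1) s2(1) by auto
  then have "10 * (max (height s1) (height s2) - min (height s1) (height s2))
      \<le> 10 * avl_height_bound n" by simp
  with s have rotates: "rotates (10 * avl_height_bound n) \<langle>s1, k, s2\<rangle> s"
    unfolding avl_joins_def by (blast intro: rotates_mono)
  have "inorder s = ks1 @ k # ks2" using rotates_inorder[OF rotates] s1(2) s2(2) by simp
  moreover have "rotates (10 * avl_height_bound n) \<langle>l, k, r\<rangle> (graft s (us1 @ us2))"
    using rotates_graft[OF rotates] graft by metis
  ultimately show ?thesis using s us by (auto simp: avl_graft_def avl_joins_def)
qed

text \<open>Rotating \<open>t\<close> brings \<open>u\<close> to the place between the keys \<open>as\<close> and \<open>cs\<close>.  The choice \<open>ms = []\<close>,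
  \<open>es = [u]\<close> then leaves \<open>u\<close> hanging there as a single tree, whereas any other view of \<open>u\<close> as an
  AVL tree with hanging trees merges it into its surroundings.\<close>

definition exposes ::
  "nat \<Rightarrow> nat \<Rightarrow> 'a list \<Rightarrow> 'a tree list \<Rightarrow> 'a list \<Rightarrow> 'a tree list \<Rightarrow> 'a tree \<Rightarrow> 'a tree \<Rightarrow> bool" where
  "exposes n c as ds cs fs t u \<longleftrightarrow>
     (\<forall>ms es. avl_graft ms es u \<longrightarrow> length (as @ ms @ cs) \<le> n \<longrightarrow>
       (\<exists>t'. avl_graft (as @ ms @ cs) (ds @ es @ fs) t' \<and> rotates c t t'))"

lemma exposesE:
  assumes "exposes n c as ds cs fs t u" "avl_graft ms es u" "length (as @ ms @ cs) \<le> n"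
  obtains t' where "avl_graft (as @ ms @ cs) (ds @ es @ fs) t'" "rotates c t t'"
  using assms unfolding exposes_def by blast

lemma avl_graft_expose_prefix:
  assumes "avl_graft (ms @ cs) (es @ fs) t" "length es = length ms + 1" "length (ms @ cs) \<le> n"
  shows "\<exists>u. avl_graft ms es u \<and> exposes n (48 * avl_height_bound n) [] [] cs fs t u"
proof (cases cs)
  case Nil
  then have "fs = []" using assms(1,2) by (simp add: avl_graft_def)
  then show ?thesis using Nil assms(1) rotates.refl
    by (intro exI[of _ t]) (auto simp: exposes_def)
next
  case (Cons c cs')
  obtain u r where ur: "avl_graft ms es u" "avl_graft cs' fs r"
    "rotates (36 * avl_height_bound n) t \<langle>u, c, r\<rangle>"
    using avl_graft_split[of ms c cs' es fs t n] assms unfolding Cons by auto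
  have "exposes n (48 * avl_height_bound n) [] [] cs fs t u"
    unfolding exposes_def append_Nil
  proof (intro allI impI)
    fix ms' es' assume u: "avl_graft ms' es' u" and n: "length (ms' @ cs) \<le> n"
    obtain t' where t': "avl_graft (ms' @ cs) (es' @ fs) t'"
      "rotates (10 * avl_height_bound n) \<langle>u, c, r\<rangle> t'"
      using avl_graft_join[OF u ur(2), of c n] n unfolding Cons by auto
    have "rotates (48 * avl_height_bound n) t t'" using ur(3) t'(2) by (rule rotates.trans) simp
    then show "\<exists>t'. avl_graft (ms' @ cs) (es' @ fs) t' \<and> rotates (48 * avl_height_bound n) t t'"
      using t'(1) by blast
  qed
  then show ?thesis using ur(1) by blast
qed

lemma exposes_append_left:
  assumes "rotates (36 * avl_height_bound n) t \<langle>l, a, r\<rangle>" "avl_graft as ds l"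
    "exposes n (48 * avl_height_bound n) [] [] cs fs r u"
  shows "exposes n (100 * avl_height_bound n) (as @ [a]) ds cs fs t u"
  unfolding exposes_def
proof (intro allI impI)
  fix ms es assume u: "avl_graft ms es u" and n: "length ((as @ [a]) @ ms @ cs) \<le> n"
  obtain r' where r': "avl_graft (ms @ cs) (es @ fs) r'" "rotates (48 * avl_height_bound n) r r'"
    using exposesE[OF assms(3) u] n by auto
  obtain t' where t': "avl_graft (as @ a # ms @ cs) (ds @ es @ fs) t'"
    "rotates (10 * avl_height_bound n) \<langle>l, a, r'\<rangle> t'"
    using avl_graft_join[OF assms(2) r'(1), of a n] n by auto
  have "rotates (84 * avl_height_bound n + 2) t \<langle>l, a, r'\<rangle>"
    using assms(1) rotates.right_subtree[OF r'(2)] by (rule rotates.trans) simp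
  moreover have "84 * avl_height_bound n + 2 + 10 * avl_height_bound n \<le> 100 * avl_height_bound n"
    using avl_height_bound_ge_2[of n] n by auto
  ultimately have "rotates (100 * avl_height_bound n) t t'" using t'(2) rotates.trans by blast
  then show "\<exists>t'. avl_graft ((as @ [a]) @ ms @ cs) (ds @ es @ fs) t' \<and>
      rotates (100 * avl_height_bound n) t t'"
    using t'(1) by auto
qed

lemma avl_graft_expose:
  assumes "avl_graft (as @ ms @ cs) (ds @ es @ fs) t" "length ds = length as"
    "length es = length ms + 1" "length (as @ ms @ cs) \<le> n"
  shows "\<exists>u. avl_graft ms es u \<and> exposes n (100 * avl_height_bound n) as ds cs fs t u"
proof (cases as rule: rev_cases)
  case Nil
  then obtain u where u: "avl_graft ms es u" "exposes n (48 * avl_height_bound n) [] [] cs fs t u"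
    using avl_graft_expose_prefix[of ms cs es fs t n] assms by auto
  have "rotates (100 * avl_height_bound n) t t'" if "rotates (48 * avl_height_bound n) t t'" for t'
    using that by (rule rotates_mono) simp
  with u(2) have "exposes n (100 * avl_height_bound n) as ds cs fs t u"
    using Nil assms(2) unfolding exposes_def by fastforce
  then show ?thesis using u(1) by blast
next
  case (snoc as' a)
  obtain l r where lr: "avl_graft as' ds l" "avl_graft (ms @ cs) (es @ fs) r"
    "rotates (36 * avl_height_bound n) t \<langle>l, a, r\<rangle>"
    using avl_graft_split[of as' a "ms @ cs" ds "es @ fs" t n] assms snoc by auto
  obtain u where u: "avl_graft ms es u" "exposes n (48 * avl_height_bound n) [] [] cs fs r u"
    using avl_graft_expose_prefix[OF lr(2) assms(3), of n] assms(4) by auto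
  then show ?thesis using exposes_append_left[OF lr(3,1) u(2)] snoc by blast
qed


section \<open>B-tree operations as regroupings of keys\<close>

text \<open>A pair \<open>(ks, ts)\<close> stands for a node, which may be empty or overfull between the phases of an
  operation.  Every operation moves at most three intervals of keys, so that at most \<open>3 * B\<close> keys
  are ever gathered in one node.\<close>

inductive regroup :: "nat \<Rightarrow> nat list \<times> btree list \<Rightarrow> nat list \<times> btree list \<Rightarrow> bool" for B where
  absorb: "length ts1 = length ks1 \<Longrightarrow> length (ks1 @ us @ ks2) \<le> 3 * B \<Longrightarrow>
    regroup B (ks1 @ ks2, ts1 @ BNode us vs # ts2) (ks1 @ us @ ks2, ts1 @ vs @ ts2)"
| detach: "length ts1 = length ks1 \<Longrightarrow> length (ks1 @ us @ ks2) \<le> 3 * B \<Longrightarrow>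
    us \<noteq> [] \<Longrightarrow> length us \<le> B - 1 \<Longrightarrow> length vs = length us + 1 \<Longrightarrow>
    regroup B (ks1 @ us @ ks2, ts1 @ vs @ ts2) (ks1 @ ks2, ts1 @ BNode us vs # ts2)"

lemmas steps_le_regroup = steps_le_step[of "regroup B" for B]

lemma regroup_absorb_two:
  assumes "length ts1 = length ks1" "length vs1 = length us1 + 1"
    "length (ks1 @ us1 @ k # us2 @ ks2) \<le> 3 * B"
  shows "steps_le (regroup B) 2 (ks1 @ k # ks2, ts1 @ BNode us1 vs1 # BNode us2 vs2 # ts2)
    (ks1 @ us1 @ k # us2 @ ks2, ts1 @ vs1 @ vs2 @ ts2)"
proof -
  have "regroup B (ks1 @ k # ks2, ts1 @ BNode us1 vs1 # BNode us2 vs2 # ts2)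
      (ks1 @ us1 @ k # ks2, ts1 @ vs1 @ BNode us2 vs2 # ts2)"
    using assms by (intro regroup.absorb) auto
  moreover have "regroup B (ks1 @ us1 @ k # ks2, ts1 @ vs1 @ BNode us2 vs2 # ts2)
      (ks1 @ us1 @ k # us2 @ ks2, ts1 @ vs1 @ vs2 @ ts2)"
    using regroup.absorb[of "ts1 @ vs1" "ks1 @ us1 @ [k]" us2 ks2 B vs2 ts2] assms by simp
  ultimately show ?thesis by (rule steps_le_trans[OF steps_le_step steps_le_step]) simp
qed

lemma regroup_detach_two:
  assumes "length ts1 = length ks1" "length (ks1 @ us1 @ k # us2 @ ks2) \<le> 3 * B"
    "us1 \<noteq> []" "length us1 \<le> B - 1" "length vs1 = length us1 + 1"
    "us2 \<noteq> []" "length us2 \<le> B - 1" "length vs2 = length us2 + 1"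
  shows "steps_le (regroup B) 2 (ks1 @ us1 @ k # us2 @ ks2, ts1 @ vs1 @ vs2 @ ts2)
    (ks1 @ k # ks2, ts1 @ BNode us1 vs1 # BNode us2 vs2 # ts2)"
proof -
  have "regroup B (ks1 @ us1 @ k # us2 @ ks2, ts1 @ vs1 @ vs2 @ ts2)
      (ks1 @ k # us2 @ ks2, ts1 @ BNode us1 vs1 # vs2 @ ts2)"
    using assms by (intro regroup.detach) auto
  moreover have "regroup B (ks1 @ k # us2 @ ks2, ts1 @ BNode us1 vs1 # vs2 @ ts2)
      (ks1 @ k # ks2, ts1 @ BNode us1 vs1 # BNode us2 vs2 # ts2)"
    using regroup.detach[of "ts1 @ [BNode us1 vs1]" "ks1 @ [k]" us2 ks2 B vs2 ts2] assms by simp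
  ultimately show ?thesis by (rule steps_le_trans[OF steps_le_step steps_le_step]) simp
qed

inductive btree_regroup :: "nat \<Rightarrow> btree \<Rightarrow> btree \<Rightarrow> bool" for B where
  refl: "btree_regroup B S S"
| regroup: "steps_le (regroup B) 3 (ks, ts) (ks', ts') \<Longrightarrow> ks' \<noteq> [] \<Longrightarrow> length ks' \<le> B - 1 \<Longrightarrow>
    btree_regroup B (BNode ks ts) (BNode ks' ts')"

fun sized_btree :: "nat \<Rightarrow> btree \<Rightarrow> bool" where
  "sized_btree B Null \<longleftrightarrow> True"
| "sized_btree B (BNode ks ts) \<longleftrightarrow> ks \<noteq> [] \<and> length ks \<le> B - 1 \<and> length ts = length ks + 1 \<and>
     (\<forall>t \<in> set ts. sized_btree B t)"

lemma sized_btree_sub: "sized_btree B T \<Longrightarrow> sized_btree B (btree_sub T p)"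
  by (induction T p rule: btree_sub.induct) auto

lemma btree_regroup_split:
  assumes "sized_btree B (BNode (ks1 @ ks2) (ts1 @ BNode (us1 @ k # us2) (vs1 @ vs2) # ts2))"
    "length ts1 = length ks1" "length vs1 = length us1 + 1" "us1 \<noteq> []" "us2 \<noteq> []"
    "length (ks1 @ ks2) < B - 1"
  shows "btree_regroup B (BNode (ks1 @ ks2) (ts1 @ BNode (us1 @ k # us2) (vs1 @ vs2) # ts2))
    (BNode (ks1 @ k # ks2) (ts1 @ BNode us1 vs1 # BNode us2 vs2 # ts2))"
proof -
  have absorb: "regroup B (ks1 @ ks2, ts1 @ BNode (us1 @ k # us2) (vs1 @ vs2) # ts2)
      (ks1 @ us1 @ k # us2 @ ks2, ts1 @ vs1 @ vs2 @ ts2)"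
    using regroup.absorb[of ts1 ks1 "us1 @ k # us2" ks2 B "vs1 @ vs2" ts2] assms by auto
  have detach: "steps_le (regroup B) 2 (ks1 @ us1 @ k # us2 @ ks2, ts1 @ vs1 @ vs2 @ ts2)
      (ks1 @ k # ks2, ts1 @ BNode us1 vs1 # BNode us2 vs2 # ts2)"
    using assms by (intro regroup_detach_two) auto
  show ?thesis
    by (rule btree_regroup.regroup[OF steps_le_trans[OF steps_le_regroup[OF absorb] detach]])
      (use assms in auto)
qed

lemma btree_regroup_split_root:
  assumes "sized_btree B (BNode (us1 @ k # us2) (vs1 @ vs2))"
    "length vs1 = length us1 + 1" "us1 \<noteq> []" "us2 \<noteq> []"
  shows "btree_regroup B (BNode (us1 @ k # us2) (vs1 @ vs2))
    (BNode [k] [BNode us1 vs1, BNode us2 vs2])"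
proof -
  have "steps_le (regroup B) 2 (us1 @ k # us2, vs1 @ vs2) ([k], [BNode us1 vs1, BNode us2 vs2])"
    using regroup_detach_two[of "[]" "[]" us1 k us2 "[]" B vs1 vs2 "[]"] assms by auto
  from steps_le_mono[OF this] show ?thesis
    by (rule btree_regroup.regroup) (use assms in auto)
qed

lemma btree_regroup_join:
  assumes "sized_btree B (BNode (ks1 @ k # ks2) (ts1 @ BNode us1 vs1 # BNode us2 vs2 # ts2))"
    "length ts1 = length ks1" "ks1 @ ks2 \<noteq> []" "length us1 + length us2 \<le> B - 2"
  shows "btree_regroup B (BNode (ks1 @ k # ks2) (ts1 @ BNode us1 vs1 # BNode us2 vs2 # ts2))
    (BNode (ks1 @ ks2) (ts1 @ BNode (us1 @ k # us2) (vs1 @ vs2) # ts2))"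
proof -
  have absorb: "steps_le (regroup B) 2 (ks1 @ k # ks2, ts1 @ BNode us1 vs1 # BNode us2 vs2 # ts2)
      (ks1 @ us1 @ k # us2 @ ks2, ts1 @ vs1 @ vs2 @ ts2)"
    using assms by (intro regroup_absorb_two) auto
  have detach: "regroup B (ks1 @ us1 @ k # us2 @ ks2, ts1 @ vs1 @ vs2 @ ts2)
      (ks1 @ ks2, ts1 @ BNode (us1 @ k # us2) (vs1 @ vs2) # ts2)"
    using regroup.detach[of ts1 ks1 "us1 @ k # us2" ks2 B "vs1 @ vs2" ts2] assms by auto
  show ?thesis
    by (rule btree_regroup.regroup[OF steps_le_trans[OF absorb steps_le_regroup[OF detach]]])
      (use assms in auto)
qed

lemma btree_regroup_join_remove:
  assumes "sized_btree B (BNode [k] [BNode us1 vs1, BNode us2 vs2])"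
    "length us1 + length us2 \<le> B - 2"
  shows "btree_regroup B (BNode [k] [BNode us1 vs1, BNode us2 vs2])
    (BNode (us1 @ k # us2) (vs1 @ vs2))"
proof -
  have "steps_le (regroup B) 2 ([k], [BNode us1 vs1, BNode us2 vs2]) (us1 @ k # us2, vs1 @ vs2)"
    using regroup_absorb_two[of "[]" "[]" vs1 us1 k us2 "[]" B vs2 "[]"] assms by auto
  from steps_le_mono[OF this] show ?thesis
    by (rule btree_regroup.regroup) (use assms in auto)
qed

lemma btree_regroup_rotate:
  assumes "sized_btree B (BNode (ks1 @ ks2) (ts1 @ BNode us vs # ts2))" "length ts1 = length ks1"
    "ks1 @ us @ ks2 = as @ bs @ cs" "ts1 @ vs @ ts2 = ds @ es @ fs"
    "length ds = length as" "length es = length bs + 1" "bs \<noteq> []" "as @ cs \<noteq> []"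
    "length bs \<le> B - 1" "length (as @ cs) \<le> B - 1"
  shows "btree_regroup B (BNode (ks1 @ ks2) (ts1 @ BNode us vs # ts2))
    (BNode (as @ cs) (ds @ BNode bs es # fs))"
proof -
  have absorb: "regroup B (ks1 @ ks2, ts1 @ BNode us vs # ts2) (as @ bs @ cs, ds @ es @ fs)"
    using assms by (intro regroup.absorb[of ts1 ks1 us ks2 B vs ts2, unfolded assms(3,4)]) auto
  have detach: "regroup B (as @ bs @ cs, ds @ es @ fs) (as @ cs, ds @ BNode bs es # fs)"
    using assms by (intro regroup.detach) auto
  show ?thesis
    by (rule btree_regroup.regroup[OF
          steps_le_trans[OF steps_le_regroup[OF absorb] steps_le_regroup[OF detach]]])
      (use assms in auto)
qed

lemma btree_regroup_rotate_remove:
  assumes "sized_btree B (BNode (ks1 @ ks2) (ts1 @ BNode us vs # ts2))" "length ts1 = length ks1"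
    "length (ks1 @ us @ ks2) \<le> B - 1"
  shows "btree_regroup B (BNode (ks1 @ ks2) (ts1 @ BNode us vs # ts2))
    (BNode (ks1 @ us @ ks2) (ts1 @ vs @ ts2))"
proof -
  have "regroup B (ks1 @ ks2, ts1 @ BNode us vs # ts2) (ks1 @ us @ ks2, ts1 @ vs @ ts2)"
    using assms by (intro regroup.absorb) auto
  from steps_le_mono[OF steps_le_regroup[OF this]] show ?thesis
    by (rule btree_regroup.regroup) (use assms in auto)
qed

lemma btree_put_sub: "btree_put T p (btree_sub T p) = T"
  by (induction T p rule: btree_sub.induct) auto

definition root_or_child :: "btree \<Rightarrow> nat list \<Rightarrow> bool" where
  "root_or_child S r \<longleftrightarrow> r = [] \<or> (\<exists>j. r = [j] \<and> btree_sub S r \<noteq> Null)"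

inductive local_regroup :: "nat \<Rightarrow> (btree, nat) config \<Rightarrow> (btree, nat) config \<Rightarrow> bool" for B where
  local_regroup: "length r \<le> 1 \<Longrightarrow> root_or_child S r' \<Longrightarrow> btree_regroup B (btree_sub T p) S \<Longrightarrow>
    local_regroup B (T, p @ r) (btree_put T p S, p @ r')"

lemma btree_step_local_regroup:
  assumes "btree_step B (T, p) (T', p')" "sized_btree B T"
  shows "local_regroup B (T, p) (T', p')"
proof -
  note local = local_regroup.intros[of _ _ _ B T]
  note sized = sized_btree_sub[OF assms(2)]
  note [simp] = root_or_child_def nth_append btree_put_sub btree_regroup.refl
  from assms(1) show ?thesis
  proof (cases rule: btree_step.cases)
    case (child ks ts i)
    then show ?thesis using local[of "[]" "btree_sub T p" "[i]" p] btree_put_sub[of T p]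
      by (simp del: btree_put_sub)
  next
    case (parent i)
    then show ?thesis using local[of "[i]" "btree_sub T p'" "[]" p'] by simp
  next
    case (split p0 ks1 ks2 ts1 us1 k us2 vs1 vs2 ts2 j)
    show ?thesis unfolding split(1-3)
      by (rule local) (use split btree_regroup_split sized[of p0] in auto)
  next
    case (split_root vs1 us1 us2 j k vs2)
    then show ?thesis using local[of "[]" "BNode [k] [BNode us1 vs1, BNode us2 vs2]" "[j]" "[]"]
        btree_regroup_split_root sized[of "[]"] by auto
  next
    case (join p0 ks1 k ks2 ts1 us1 vs1 us2 vs2 ts2 j)
    show ?thesis unfolding join(1-3)
      by (rule local) (use join btree_regroup_join sized[of p0] in auto)
  next
    case (join_remove k us1 vs1 us2 vs2 j)
    then show ?thesis using local[of "[j]" "BNode (us1 @ k # us2) (vs1 @ vs2)" "[]" p']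
        btree_regroup_join_remove sized[of p'] by auto
  next
    case (rotate p0 ks1 ks2 ts1 us vs ts2 as bs cs ds es fs)
    define r' where "r' = (if p' = p0 then [] else [length ds])"
    have "p' = p0 @ r'" using rotate by (auto simp: r'_def)
    show ?thesis unfolding rotate(1,2) \<open>p' = p0 @ r'\<close>
      by (rule local) (use rotate btree_regroup_rotate sized[of p0] in \<open>auto simp: r'_def\<close>)
  next
    case (rotate_remove ks1 ks2 ts1 us vs ts2)
    then show ?thesis
      using local[of "[length ts1]" "BNode (ks1 @ us @ ks2) (ts1 @ vs @ ts2)" "[]" p']
        btree_regroup_rotate_remove sized[of p'] by auto
  qed
qed


section \<open>Representing B-trees by BSTs\<close>

abbreviation node_height_bound :: "nat \<Rightarrow> nat" where
  "node_height_bound B \<equiv> avl_height_bound (3 * B)"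

inductive rep :: "nat \<Rightarrow> btree \<Rightarrow> nat tree \<Rightarrow> bool" for B where
  Null: "rep B Null Leaf"
| BNode: "ks \<noteq> [] \<Longrightarrow> length ks \<le> B - 1 \<Longrightarrow> list_all2 (rep B) ts us \<Longrightarrow> avl_graft ks us t \<Longrightarrow>
    rep B (BNode ks ts) t"

definition node_rep :: "nat \<Rightarrow> nat list \<Rightarrow> btree list \<Rightarrow> nat tree \<Rightarrow> bool" where
  "node_rep B ks ts t \<longleftrightarrow> (\<exists>us. list_all2 (rep B) ts us \<and> avl_graft ks us t)"

lemma rep_BNode:
  "rep B (BNode ks ts) t \<longleftrightarrow> ks \<noteq> [] \<and> length ks \<le> B - 1 \<and> node_rep B ks ts t"
  by (auto simp: node_rep_def elim!: rep.cases intro: rep.BNode)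

lemma rep_not_Leaf: "rep B T t \<Longrightarrow> T \<noteq> Null \<Longrightarrow> t \<noteq> Leaf"
  by (auto simp: avl_graft_def neq_Leaf_iff elim!: rep.cases)

lemma rep_sized_btree: "rep B T t \<Longrightarrow> sized_btree B T"
proof (induction rule: rep.induct)
  case (BNode ks ts us t)
  then have "length ts = length ks + 1" by (auto simp: avl_graft_def dest: list_all2_lengthD)
  moreover have "\<forall>t \<in> set ts. sized_btree B t"
    using BNode.IH by (auto simp: list_all2_conv_all_nth in_set_conv_nth)
  ultimately show ?case using BNode.hyps by simp
qed simp

lemma is_btree_rep:
  "is_btree B T \<Longrightarrow> \<exists>t. rep B T t \<and> set_tree t = btree_keys T \<and> bst t"
proof (induction T)
  case Null
  then show ?case by (intro exI[of _ Leaf]) (auto intro: rep.Null)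
next
  case (BNode ks ts)
  then have "\<forall>T \<in> set ts. \<exists>t. rep B T t \<and> set_tree t = btree_keys T \<and> bst t" by auto
  then obtain f where
    f: "\<And>T. T \<in> set ts \<Longrightarrow> rep B T (f T) \<and> set_tree (f T) = btree_keys T \<and> bst (f T)"
    by metis
  obtain s where s: "avl s" "inorder s = ks" using avl_exists by blast
  then have size: "size1 s = length (map f ts)"
    using BNode.prems by (metis is_btree.simps(2) length_inorder length_map size1_size)
  define t where "t = graft s (map f ts)"
  have "list_all2 (rep B) ts (map f ts)" using f by (auto simp: list_all2_conv_all_nth)
  then have "rep B (BNode ks ts) t"
    using BNode.prems s by (intro rep.BNode) (auto simp: avl_graft_def t_def)
  moreover have "set_tree t = btree_keys (BNode ks ts)"
    using f size set_inorder[of s] s(2) by (simp add: t_def set_tree_graft)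
  moreover have "bst t"
    unfolding t_def
  proof (rule bst_graft)
    show "bst s" using BNode.prems s by (simp add: bst_iff_sorted_wrt_less)
    show "separates (inorder s) (map set_tree (map f ts))"
      using BNode.prems f s(2) by (auto simp: separates_def)
  qed (use f size in auto)
  ultimately show ?case by blast
qed

lemma node_rep_absorb:
  assumes "node_rep B (ks1 @ ks2) (ts1 @ BNode us vs # ts2) t" "length ts1 = length ks1"
    "length (ks1 @ us @ ks2) \<le> n"
  shows "\<exists>t'. node_rep B (ks1 @ us @ ks2) (ts1 @ vs @ ts2) t' \<and>
    rotates (100 * avl_height_bound n) t t'"
proof -
  obtain ss1 u ss2 where ss: "list_all2 (rep B) ts1 ss1" "rep B (BNode us vs) u"
    "list_all2 (rep B) ts2 ss2" "avl_graft (ks1 @ [] @ ks2) (ss1 @ [u] @ ss2) t"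
    using assms(1) by (auto simp: node_rep_def list_all2_append1 list_all2_Cons1)
  obtain ws where ws: "list_all2 (rep B) vs ws" "avl_graft us ws u"
    using ss(2) by (auto simp: rep_BNode node_rep_def)
  have "length ss1 = length ks1" using ss(1) assms(2) by (auto dest: list_all2_lengthD)
  then have "exposes n (100 * avl_height_bound n) ks1 ss1 ks2 ss2 t u"
    using avl_graft_expose[OF ss(4), of n] assms(3) by (auto simp: avl_graft_Nil)
  then obtain t' where t': "avl_graft (ks1 @ us @ ks2) (ss1 @ ws @ ss2) t'"
    "rotates (100 * avl_height_bound n) t t'"
    using ws(2) assms(3) by (rule exposesE)
  have "list_all2 (rep B) (ts1 @ vs @ ts2) (ss1 @ ws @ ss2)"
    using ss ws by (auto intro: list_all2_appendI)
  then show ?thesis using t' by (auto simp: node_rep_def)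
qed

lemma node_rep_detach:
  assumes "node_rep B (ks1 @ us @ ks2) (ts1 @ vs @ ts2) t" "length ts1 = length ks1"
    "length vs = length us + 1" "us \<noteq> []" "length us \<le> B - 1" "length (ks1 @ us @ ks2) \<le> n"
  shows "\<exists>t'. node_rep B (ks1 @ ks2) (ts1 @ BNode us vs # ts2) t' \<and>
    rotates (100 * avl_height_bound n) t t'"
proof -
  obtain ss1 ws ss2 where ss: "list_all2 (rep B) ts1 ss1" "list_all2 (rep B) vs ws"
    "list_all2 (rep B) ts2 ss2" "avl_graft (ks1 @ us @ ks2) (ss1 @ ws @ ss2) t"
    using assms(1) by (auto simp: node_rep_def list_all2_append1)
  have len: "length ss1 = length ks1" "length ws = length us + 1"
    using ss assms(2,3) by (auto dest: list_all2_lengthD)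
  obtain u where u: "avl_graft us ws u" "exposes n (100 * avl_height_bound n) ks1 ss1 ks2 ss2 t u"
    using avl_graft_expose[OF ss(4) len assms(6)] by blast
  obtain t' where t': "avl_graft (ks1 @ [] @ ks2) (ss1 @ [u] @ ss2) t'"
    "rotates (100 * avl_height_bound n) t t'"
    using u(2)
    by (rule exposesE[where ms = "[]" and es = "[u]"])
      (use assms(6) in \<open>auto simp: avl_graft_Nil\<close>)
  have "rep B (BNode us vs) u" using assms(4,5) ss(2) u(1) by (auto simp: rep_BNode node_rep_def)
  then have "list_all2 (rep B) (ts1 @ BNode us vs # ts2) (ss1 @ u # ss2)"
    using ss by (auto intro: list_all2_appendI)
  then show ?thesis using t' by (auto simp: node_rep_def)
qed

lemma node_rep_regroup:
  assumes "regroup B (ks, ts) (ks', ts')" "node_rep B ks ts t"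
  shows "\<exists>t'. node_rep B ks' ts' t' \<and> rotates (100 * node_height_bound B) t t'"
  using assms(1)
proof cases
  case absorb
  then show ?thesis using node_rep_absorb assms(2) by simp
next
  case detach
  then show ?thesis using node_rep_detach assms(2) by simp
qed

lemma rep_btree_regroup:
  assumes "btree_regroup B S S'" "rep B S t"
  shows "\<exists>t'. rep B S' t' \<and> steps_le bst_step (300 * node_height_bound B) (t, []) (t', [])"
  using assms(1)
proof cases
  case refl
  then show ?thesis using assms(2) by (auto intro: steps_le_refl)
next
  case (regroup ks ts ks' ts')
  define sim where "sim = (\<lambda>(ks, ts) (t, q). node_rep B ks ts t \<and> q = ([] :: dir list))"
  have step: "\<exists>y'. sim x' y' \<and> steps_le bst_step (100 * node_height_bound B) y y'"
    if "regroup B x x'" "sim x y" for x x' y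
  proof -
    obtain t where y: "y = (t, [])" "node_rep B (fst x) (snd x) t"
      using \<open>sim x y\<close> by (auto simp: sim_def split: prod.splits)
    obtain t' where "node_rep B (fst x') (snd x') t'"
      "rotates (100 * node_height_bound B) t t'"
      using node_rep_regroup[OF _ y(2)] \<open>regroup B x x'\<close> by (metis prod.collapse)
    then show ?thesis
      using rotates_steps_le y(1)
      by (intro exI[of _ "(t', [])"]) (auto simp: sim_def split: prod.splits)
  qed
  have init: "sim (ks, ts) (t, [])" using assms(2) regroup by (simp add: sim_def rep_BNode)
  have "\<exists>y'. sim (ks', ts') y' \<and>
      steps_le bst_step (3 * (100 * node_height_bound B)) (t, []) y'"
    by (rule steps_le_simulation[where sim = sim, OF _ regroup(3) init]) (rule step)
  then obtain t' where "node_rep B ks' ts' t'"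
    "steps_le bst_step (300 * node_height_bound B) (t, []) (t', [])"
    by (auto simp: sim_def)
  then show ?thesis using regroup by (auto simp: rep_BNode)
qed


section \<open>Simulating the B-tree operations\<close>

text \<open>The pointer of the BST is kept at the root of the AVL tree that represents the current
  node of the B-tree.\<close>

inductive config_rep :: "nat \<Rightarrow> (btree, nat) config \<Rightarrow> (nat tree, dir) config \<Rightarrow> bool" for B where
  root: "rep B T t \<Longrightarrow> config_rep B (T, []) (t, [])"
| child: "ks \<noteq> [] \<Longrightarrow> length ks \<le> B - 1 \<Longrightarrow> list_all2 (rep B) ts us \<Longrightarrow>
    avl s \<Longrightarrow> inorder s = ks \<Longrightarrow> length us = size1 s \<Longrightarrow> i < length ts \<Longrightarrow>
    config_rep B (ts ! i, p) (us ! i, q) \<Longrightarrow>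
    config_rep B (BNode ks ts, i # p) (graft s us, leaf_path s i @ q)"

inductive_cases config_rep_NilE: "config_rep B (T, []) (t, q)"
inductive_cases config_rep_ConsE: "config_rep B (T, i # p) (t, q)"

lemma config_repD: "config_rep B (T, p) (t, q) \<Longrightarrow> rep B T t"
  by (induction "(T, p)" "(t, q)" arbitrary: T p t q rule: config_rep.induct)
    (auto intro: rep.BNode avl_graftI)

lemma config_rep_short_path:
  assumes "config_rep B (T, p) (t, q)" "length p \<le> 1"
  shows "length q \<le> node_height_bound B"
  using assms(1)
proof cases
  case (child ks ts us s i p' q')
  then have "q' = []" using assms(2) by (auto elim: config_rep_NilE)
  moreover have "height s \<le> node_height_bound B"
    using child by (intro avl_height_le_bound) auto
  ultimately show ?thesis using child length_leaf_path[of s i] by simp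
qed simp

lemma config_rep_update_child:
  assumes "ks \<noteq> []" "length ks \<le> B - 1" "list_all2 (rep B) ts us" "avl s" "inorder s = ks"
    "length us = size1 s" "i < length ts" "config_rep B (S, p) (u, q)"
  shows "config_rep B (BNode ks (ts[i := S]), i # p) (graft s (us[i := u]), leaf_path s i @ q)"
proof -
  have "i < length us" using assms(3,7) by (auto dest: list_all2_lengthD)
  moreover have "list_all2 (rep B) (ts[i := S]) (us[i := u])"
    using assms(3) config_repD[OF assms(8)] by (rule list_all2_update_cong)
  ultimately show ?thesis using assms by (intro config_rep.child) auto
qed

lemma config_rep_append:
  assumes "config_rep B (T, p @ r) (t, q)"
  shows "\<exists>q1 q2. q = q1 @ q2 \<and> config_rep B (btree_sub T p, r) (bst_sub t q1, q2) \<and>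
    (\<forall>S r' s q'. config_rep B (S, r') (s, q') \<longrightarrow>
      config_rep B (btree_put T p S, p @ r') (bst_put t q1 s, q1 @ q'))"
  using assms
proof (induction p arbitrary: T t q)
  case Nil
  then show ?case by (intro exI[of _ "[]"] exI[of _ q]) auto
next
  case (Cons i p)
  then have "config_rep B (T, i # (p @ r)) (t, q)" by simp
  then obtain ks ts us s q' where T: "T = BNode ks ts" and t: "t = graft s us"
    and q: "q = leaf_path s i @ q'" and node: "ks \<noteq> []" "length ks \<le> B - 1"
      "list_all2 (rep B) ts us" "avl s" "inorder s = ks" "length us = size1 s" "i < length ts"
    and rep_i: "config_rep B (ts ! i, p @ r) (us ! i, q')"
    by (auto elim!: config_rep_ConsE)
  from Cons.IH[OF rep_i] obtain q1 q2 where
    q12: "q' = q1 @ q2" "config_rep B (btree_sub (ts ! i) p, r) (bst_sub (us ! i) q1, q2)"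
    and put: "\<And>S r' s q'. config_rep B (S, r') (s, q') \<Longrightarrow>
      config_rep B (btree_put (ts ! i) p S, p @ r') (bst_put (us ! i) q1 s, q1 @ q')"
    by blast
  have "i < size1 s" using node(3,6,7) by (auto dest: list_all2_lengthD)
  note path = bst_sub_graft_leaf_path[OF node(6) this] bst_put_graft_leaf_path[OF node(6) this]
  let ?q1 = "leaf_path s i @ q1"
  have "config_rep B (btree_put T (i # p) S, (i # p) @ r') (bst_put t ?q1 s', ?q1 @ qs)"
    if "config_rep B (S, r') (s', qs)" for S r' s' qs
    using config_rep_update_child[OF node put[OF that]] node(7)
    by (simp add: T t bst_put_append path)
  moreover have "q = ?q1 @ q2" using q q12(1) by simp
  moreover have "config_rep B (btree_sub T (i # p), r) (bst_sub t ?q1, q2)"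
    using node(7) q12(2) by (simp add: T t bst_sub_append path)
  ultimately show ?case by blast
qed

lemma config_rep_descend:
  assumes "rep B S s" "root_or_child S r"
  shows "\<exists>q. config_rep B (S, r) (s, q) \<and> steps_le bst_step (node_height_bound B) (s, []) (s, q)"
  using assms(2) unfolding root_or_child_def
proof
  assume "r = []"
  then show ?thesis using assms(1) by (auto intro: config_rep.root steps_le_refl)
next
  assume "\<exists>j. r = [j] \<and> btree_sub S r \<noteq> Null"
  then obtain j ks ts where r: "r = [j]" and S: "S = BNode ks ts" "j < length ts" "ts ! j \<noteq> Null"
    by (cases S) (auto split: if_splits)
  obtain us s' where ks: "ks \<noteq> []" "length ks \<le> B - 1" and us: "list_all2 (rep B) ts us"
    "avl s'" "inorder s' = ks" "length us = size1 s'" "s = graft s' us"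
    using assms(1) unfolding S rep_BNode node_rep_def avl_graft_def by (auto simp: size1_size)
  have j: "j < size1 s'" "rep B (ts ! j) (us ! j)"
    using us S by (auto dest: list_all2_lengthD list_all2_nthD)
  let ?q = "leaf_path s' j"
  have "config_rep B (S, r) (s, ?q @ [])"
    unfolding S r us(5) using ks us(1-4) S(2) j by (intro config_rep.child config_rep.root) auto
  then have config_rep: "config_rep B (S, r) (s, ?q)" by simp
  have "bst_sub s ?q = us ! j" using us(4,5) j(1) bst_sub_graft_leaf_path by simp
  then have "steps_le bst_step (length ?q) (s, []) (s, ?q)"
    using rep_not_Leaf[OF j(2) S(3)] by (intro steps_le_descend) simp
  moreover have "length ?q \<le> node_height_bound B"
    using config_rep_short_path[OF config_rep] r by simp
  ultimately show ?thesis using config_rep by (blast intro: steps_le_mono)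
qed

lemma config_rep_step:
  assumes "btree_step B (T, p) (T', p')" "config_rep B (T, p) (t, q)"
  shows "\<exists>t' q'. config_rep B (T', p') (t', q') \<and>
    steps_le bst_step (302 * node_height_bound B) (t, q) (t', q')"
proof -
  let ?H = "node_height_bound B"
  have "local_regroup B (T, p) (T', p')"
    using btree_step_local_regroup[OF assms(1) rep_sized_btree[OF config_repD[OF assms(2)]]] .
  then obtain p0 r r' S where p: "p = p0 @ r" "p' = p0 @ r'" "T' = btree_put T p0 S" "length r \<le> 1"
    and S: "root_or_child S r'" "btree_regroup B (btree_sub T p0) S"
    by (auto elim: local_regroup.cases)
  obtain q1 q2 where q: "q = q1 @ q2" "config_rep B (btree_sub T p0, r) (bst_sub t q1, q2)"
    and put: "\<And>S r' s q'. config_rep B (S, r') (s, q') \<Longrightarrow>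
      config_rep B (btree_put T p0 S, p0 @ r') (bst_put t q1 s, q1 @ q')"
    using config_rep_append[OF assms(2)[unfolded p(1)]] by blast
  obtain s where s: "rep B S s" "steps_le bst_step (300 * ?H) (bst_sub t q1, []) (s, [])"
    using rep_btree_regroup[OF S(2) config_repD[OF q(2)]] by blast
  obtain q3 where q3: "config_rep B (S, r') (s, q3)" "steps_le bst_step ?H (s, []) (s, q3)"
    using config_rep_descend[OF s(1) S(1)] by blast
  have "steps_le bst_step ?H (bst_sub t q1, q2) (bst_sub t q1, [])"
    using steps_le_mono[OF steps_le_ascend[of q2 _ "[]"] config_rep_short_path[OF q(2) p(4)]]
    by simp
  then have "steps_le bst_step (301 * ?H) (bst_sub t q1, q2) (s, [])"
    using s(2) by (rule steps_le_trans) simp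
  then have "steps_le bst_step (302 * ?H) (bst_sub t q1, q2) (s, q3)"
    using q3(2) by (rule steps_le_trans) simp
  then have "steps_le bst_step (302 * ?H) (t, q) (bst_put t q1 s, q1 @ q3)"
    unfolding q(1) by (rule steps_le_bst_context)
  then show ?thesis using put[OF q3(1)] p by blast
qed

lemma config_rep_touch:
  assumes "config_rep B (T, p) (t, q)" "x \<in> btree_node_keys (T, p)"
  shows "\<exists>q'. x \<in> bst_node_keys (t, q') \<and>
    steps_le bst_step (node_height_bound B) (t, q) (t, q') \<and>
    steps_le bst_step (node_height_bound B) (t, q') (t, q)"
proof -
  obtain q1 q2 where "q = q1 @ q2" "config_rep B (btree_sub T p, []) (bst_sub t q1, q2)"
    using config_rep_append[of B T p "[]" t q] assms(1) by auto
  then have rep: "rep B (btree_sub T p) (bst_sub t q)" by (auto elim: config_rep_NilE)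
  obtain ks ts where S: "btree_sub T p = BNode ks ts" "x \<in> set ks"
    using assms(2) by (auto split: btree.splits)
  obtain s us where s: "avl s" "inorder s = ks" "bst_sub t q = graft s us" and "length ks \<le> B - 1"
    using rep S(1) by (auto simp: rep_BNode node_rep_def avl_graft_def)
  have "x \<in> set_tree s" using s(2) S(2) by (simp flip: set_inorder)
  then obtain q' l r where q': "length q' \<le> height s" "bst_sub (graft s us) q' = \<langle>l, x, r\<rangle>"
    using graft_key_path by blast
  have "height s \<le> node_height_bound B"
    using s(1,2) \<open>length ks \<le> B - 1\<close> by (intro avl_height_le_bound) auto
  then have len: "length q' \<le> node_height_bound B" using q'(1) by simp
  have "steps_le bst_step (length q') (bst_sub t q, []) (bst_sub t q, q')"
    using q'(2) s(3) by (intro steps_le_descend) simp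
  from steps_le_bst_context[OF this] have "steps_le bst_step (length q') (t, q) (t, q @ q')"
    by (simp add: bst_put_sub)
  moreover have "x \<in> bst_node_keys (t, q @ q')" using q'(2) s(3) by (simp add: bst_sub_append)
  ultimately show ?thesis using len by (blast intro: steps_le_mono steps_le_ascend)
qed

lemma search_simulation_config_rep:
  "search_simulation (btree_step B) btree_node_keys bst_step bst_node_keys (config_rep B)
    (302 * node_height_bound B) (node_height_bound B)"
proof
  show "\<exists>y'. config_rep B x' y' \<and> steps_le bst_step (302 * node_height_bound B) y y'"
    if "btree_step B x x'" "config_rep B x y" for x x' y
    using that config_rep_step[of B "fst x" "snd x" "fst x'" "snd x'" "fst y" "snd y"] by auto
  show "\<exists>y'. a \<in> bst_node_keys y' \<and> steps_le bst_step (node_height_bound B) y y' \<and>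
      steps_le bst_step (node_height_bound B) y' y"
    if "config_rep B x y" "a \<in> btree_node_keys x" for x y a
    using that config_rep_touch[of B "fst x" "snd x" "fst y" "snd y" a] by auto
qed (auto intro: config_rep.root config_repD)

lemma node_height_bound_le_log:
  assumes "2 \<le> B"
  shows "real (node_height_bound B) \<le> 6 * log 2 (real B)"
proof -
  have "log 2 (real (3 * B) + 1) \<le> log 2 (2 ^ 2 * real B)" using assms by simp
  also have "\<dots> = log 2 (2 ^ 2) + log 2 (real B)" using assms by (subst log_mult) auto
  also have "log 2 (2 ^ 2) = (2 :: real)" by (subst log_pow_cancel) auto
  also have "2 + log 2 (real B) \<le> 3 * log 2 (real B)"
  proof -
    have "1 \<le> log 2 (real B)" using assms by (simp add: le_log_iff)
    then show ?thesis by simp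
  qed
  finally have "2 * log 2 (real (3 * B) + 1) \<le> 6 * log 2 (real B)" by simp
  moreover have "real (node_height_bound B) \<le> 2 * log 2 (real (3 * B) + 1)"
    unfolding avl_height_bound_def by (rule of_nat_floor) simp
  ultimately show ?thesis by (rule order_trans[rotated])
qed

lemma opt_bst_le:
  assumes "2 \<le> B" "set X \<subseteq> {1..N}"
  shows "opt_bst N X \<le> opt_btree B N X * (305 * node_height_bound B)"
proof -
  let ?H = "node_height_bound B"
  obtain T T' where T: "is_btree B T" "btree_keys T = {1..N}"
    "serves (btree_step B) btree_node_keys X T T' (opt_btree B N X)"
    using opt_btree_attained[OF assms] by (auto simp: btree_costs_def)
  obtain t where t: "rep B T t" "set_tree t = {1..N}" "bst t"
    using is_btree_rep[OF T(1)] T(2) by auto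
  obtain t' c where c: "serves bst_step bst_node_keys X t t' c"
    "c \<le> opt_btree B N X * (1 + 302 * ?H + 2 * ?H)"
    using search_simulation.simulates_serves[OF search_simulation_config_rep T(3)
        config_rep.root[OF t(1)]] by blast
  have "c \<in> bst_costs N X" using c(1) t by (auto simp: bst_costs_def)
  then have "opt_bst N X \<le> c" unfolding opt_bst_def by (rule wellorder_Inf_le1)
  also note c(2)
  also have "1 + 302 * ?H + 2 * ?H \<le> 305 * ?H"
    using avl_height_bound_ge_2[of "3 * B"] assms(1) by simp
  finally show ?thesis by simp
qed

theorem theorem1:
  shows "\<exists>C::real. C > 0 \<and>
    (\<forall>(B::nat) (N::nat) (X::nat list). B \<ge> 2 \<longrightarrow> set X \<subseteq> {1..N} \<longrightarrow>
      real (opt_bst N X) \<le> C * (real (opt_btree B N X) * log 2 (real B)))"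
proof (intro exI[of _ 1830] conjI allI impI)
  fix B N :: nat and X :: "nat list"
  assume B: "B \<ge> 2" and X: "set X \<subseteq> {1..N}"
  have "real (opt_bst N X) \<le> real (opt_btree B N X * (305 * node_height_bound B))"
    using opt_bst_le[OF B X] by (simp only: of_nat_le_iff)
  also have "\<dots> = 305 * (real (opt_btree B N X) * real (node_height_bound B))" by simp
  also have "\<dots> \<le> 305 * (real (opt_btree B N X) * (6 * log 2 (real B)))"
    using node_height_bound_le_log[OF B] by (intro mult_left_mono) auto
  finally show "real (opt_bst N X) \<le> 1830 * (real (opt_btree B N X) * log 2 (real B))" by simp
qed simp

end
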